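(* There exists a translation invariant site percolation $\hat{X}$ on $\mathbb{Z}^2$ such that with probability $1$ we have both $p_{c,bond}(G_{open}(\hat{X}))<1$ and $p_{c,bond}(G_{closed}(\hat{X}))<1$.
   Context: A site percolation on $\mathbb{Z}^2$ is a $\{0,1\}^{\mathbb{Z}^2}$-valued random object $\hat{X}$. It is translation invariant if for any $n$ and any $x_1,\ldots,x_n\in\mathbb{Z}^2$, the distribution of $(\hat{X}(x_1+y),\ldots,\hat{X}(x_n+y))$ does not depend on $y\in\mathbb{Z}^2$. Given a site percolation $\hat{X}$ on $\mathbb{Z}^2$, $G_{open}(\hat{X})$ denotes the (random) graph whose vertex set consists of all $x\in\mathbb{Z}^2$ with $\hat{X}(x)=1$, and whose edge set consists of all pairs of such vertices at $L_1$-distance $1$ from each other. Analogously, $G_{closed}(\hat{X})$ has vertex set consisting of all $x\in\mathbb{Z}^2$ with $\hat{X}(x)=0$, and edge set consisting of all pairs of such vertices at $L_1$-distance $1$ from each other. For an infinite but locally finite graph $G$, $p_{c,bond}(G)$ is the infimum over all $p\in[0,1]$ such that i.i.d. bond percolation on $G$ with retention parameter $p$ (each edge is independently retained with probability $p$ and removed otherwise) produces a.s. at least one infinite open cluster, i.e. an infinite connected component of retained edges. *)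

theory Defs
  imports "HOL-Probability.Probability"
begin

section \<open>Bond percolation on a graph\<close>

text \<open>An undirected simple graph is a pair of its vertex set and its set of edges, each edge
  being a two-element set of vertices.\<close>

type_synonym 'a graph = "'a set \<times> 'a set set"

abbreviation verts :: "'a graph \<Rightarrow> 'a set" where
  "verts G \<equiv> fst G"

abbreviation edges :: "'a graph \<Rightarrow> 'a set set" where
  "edges G \<equiv> snd G"

definition component :: "'a graph \<Rightarrow> 'a \<Rightarrow> 'a set" where
  "component G x = {y. (x, y) \<in> {(u, v). {u, v} \<in> edges G}\<^sup>*}"

definition has_infinite_component :: "'a graph \<Rightarrow> bool" where
  "has_infinite_component G \<longleftrightarrow> (\<exists>x\<in>verts G. infinite (component G x))"

definition bond_percolation :: "'a graph \<Rightarrow> real \<Rightarrow> ('a set \<Rightarrow> bool) measure" where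
  "bond_percolation G p = (\<Pi>\<^sub>M e\<in>edges G. measure_pmf (bernoulli_pmf p))"

definition retained :: "'a graph \<Rightarrow> ('a set \<Rightarrow> bool) \<Rightarrow> 'a graph" where
  "retained G \<eta> = (verts G, {e \<in> edges G. \<eta> e})"

text \<open>The infimum is taken in the extended reals, so that it is \<open>\<infinity>\<close> (and not an unspecified
  real number) when there is no admissible \<open>p\<close>, i.e. when \<open>G\<close> has no infinite component.\<close>

definition p_c_bond :: "'a graph \<Rightarrow> ereal" where
  "p_c_bond G =
     (INF p \<in> {p \<in> {0..1}. AE \<eta> in bond_percolation G p. has_infinite_component (retained G \<eta>)}.
        ereal p)"


section \<open>Site percolation on the square lattice\<close>

text \<open>The states \<open>1\<close> (open) and \<open>0\<close> (closed) are encoded as \<^const>\<open>True\<close> and \<^const>\<open>False\<close>.\<close>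

type_synonym site = "int \<times> int"

definition site_percolation :: "'w measure \<Rightarrow> ('w \<Rightarrow> site \<Rightarrow> bool) \<Rightarrow> bool" where
  "site_percolation M X \<longleftrightarrow>
     prob_space M \<and> X \<in> M \<rightarrow>\<^sub>M (\<Pi>\<^sub>M x\<in>UNIV. count_space UNIV)"

text \<open>The tuple \<open>x\<^sub>1, \<dots>, x\<^sub>n\<close> is the list \<open>xs\<close>.\<close>

definition translation_invariant :: "'w measure \<Rightarrow> ('w \<Rightarrow> site \<Rightarrow> bool) \<Rightarrow> bool" where
  "translation_invariant M X \<longleftrightarrow>
     (\<forall>xs y y'. distr M (count_space UNIV) (\<lambda>\<omega>. map (\<lambda>x. X \<omega> (x + y)) xs) =
                distr M (count_space UNIV) (\<lambda>\<omega>. map (\<lambda>x. X \<omega> (x + y')) xs))"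

definition L1_dist :: "site \<Rightarrow> site \<Rightarrow> int" where
  "L1_dist x y = \<bar>fst x - fst y\<bar> + \<bar>snd x - snd y\<bar>"

definition lattice_graph_on :: "site set \<Rightarrow> site graph" where
  "lattice_graph_on V = (V, {{x, y} | x y. x \<in> V \<and> y \<in> V \<and> L1_dist x y = 1})"

definition G_open :: "(site \<Rightarrow> bool) \<Rightarrow> site graph" where
  "G_open \<xi> = lattice_graph_on {x. \<xi> x}"

definition G_closed :: "(site \<Rightarrow> bool) \<Rightarrow> site graph" where
  "G_closed \<xi> = lattice_graph_on {x. \<not> \<xi> x}"

end

theory Submission
  imports Defs
begin

text \<open>
  The site percolation consists of random strips on a sequence of rapidly growing scales.  Level \<open>n\<close>
  has parallel strips of width about \<open>n\<^sup>2\<close>, alternately open and closed, at distance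
  \<open>gap n = 4 * 2 ^ (n\<^sup>2)\<close> from each other and shifted by a uniform random offset; strips of even levels are
  horizontal, those of odd levels are vertical, and strips of higher levels are painted over those
  of lower levels.  Uniform independent offsets make this translation invariant.

  By the Borel--Cantelli lemma, almost surely no strip of a large level \<open>n + 1\<close> comes within
  distance \<open>gap n\<close> of the origin (\<open>AE_eventually_far_strips\<close>).  Fix a colour.  As the colours
  alternate, one of the two strips of level \<open>n\<close> next to the origin has this colour, and one can follow it
  until it merges into a strip of the same colour of level \<open>n + 1\<close> without being cut by the other
  colour or by higher levels.  The result is an infinite monochromatic corridor, made of rectangles that are
  alternately horizontal and vertical, each overlapping the next (\<open>corridor_in_coloring\<close>).  This
  works for both colours at once.

  The \<open>n\<close>-th rectangle is roughly \<open>n\<^sup>2\<close> wide and \<open>2 ^ ((n + 1)\<^sup>2)\<close> long, so its length is at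
  most exponential in its width.  By a Peierls argument, bond percolation with retention close to
  one fails to cross it lengthwise with summable probability: a failure needs a dual path of closed edges across the
  rectangle (\<open>crossing_blockers\<close>), and there are few such paths compared to their probability.
  Hence almost surely all but finitely many rectangles are crossed.  Crossings of consecutive
  rectangles intersect for topological reasons (\<open>crossing_walks_meet\<close>), and together they form an
  infinite cluster (\<open>p_c_bond_less_1_if_corridor\<close>).

  Both planar facts, the existence of the dual path and the intersection of crossings, are proved by
  counting modulo two.
\<close>


section \<open>Parity along walks and the intersection of crossings\<close>

text \<open>Both planarity arguments below count steps of a walk modulo two.  \<open>odd_steps s xs\<close> is the parity
  of the number of consecutive pairs of \<open>xs\<close> that satisfy \<open>s\<close>; if \<open>s\<close> records the changes of a
  predicate along the walk, this parity only depends on the two ends.\<close>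

fun odd_steps :: "('a \<Rightarrow> 'a \<Rightarrow> bool) \<Rightarrow> 'a list \<Rightarrow> bool" where
  "odd_steps s (a # b # xs) \<longleftrightarrow> s a b \<noteq> odd_steps s (b # xs)"
| "odd_steps s _ \<longleftrightarrow> False"

lemma odd_steps_cong:
  assumes "successively (\<lambda>a b. s a b \<longleftrightarrow> t a b) xs"
  shows "odd_steps s xs \<longleftrightarrow> odd_steps t xs"
  using assms by (induction s xs rule: odd_steps.induct) auto

lemma odd_steps_xor:
  "odd_steps (\<lambda>a b. s a b \<noteq> t a b) xs \<longleftrightarrow> odd_steps s xs \<noteq> odd_steps t xs"
  by (induction s xs rule: odd_steps.induct) auto

lemma odd_steps_telescope:
  fixes g :: "'a \<Rightarrow> bool"
  assumes "successively (\<lambda>a b. s a b \<longleftrightarrow> g a \<noteq> g b) xs" "xs \<noteq> []"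
  shows "odd_steps s xs \<longleftrightarrow> g (hd xs) \<noteq> g (last xs)"
  using assms by (induction s xs rule: odd_steps.induct) auto

lemma odd_steps_cong_if_xor_telescopes:
  fixes g :: "'a \<Rightarrow> bool"
  assumes "successively (\<lambda>a b. (s a b \<noteq> t a b) \<longleftrightarrow> g a \<noteq> g b) xs" "xs \<noteq> []"
    and "g (hd xs) \<longleftrightarrow> g (last xs)"
  shows "odd_steps s xs \<longleftrightarrow> odd_steps t xs"
  using odd_steps_telescope[OF assms(1,2)] assms(3) odd_steps_xor[of s t xs] by blast

lemma odd_steps_imp_step:
  assumes "odd_steps s xs" "successively Q xs"
  shows "\<exists>a b. a \<in> set xs \<and> b \<in> set xs \<and> Q a b \<and> s a b"
  using assms by (induction s xs rule: odd_steps.induct) fastforce+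

lemma successively_imp_all_eq_hd:
  assumes "successively (\<lambda>a b. f a = f b) xs" "x \<in> set xs"
  shows "f x = f (hd xs)"
  using assms by (induction xs rule: induct_list012) (auto split: if_splits)

lemma successively_conj_set:
  "successively P xs \<Longrightarrow> successively (\<lambda>a b. P a b \<and> a \<in> set xs \<and> b \<in> set xs) xs"
  by (rule successively_cong[THEN iffD1, rotated 2]) auto

abbreviation lattice_walk :: "site list \<Rightarrow> bool" where
  "lattice_walk \<equiv> successively (\<lambda>u v. L1_dist u v = 1)"

text \<open>The parity of the number of times the walk crosses the ray that starts at height \<open>snd u + 1 / 2\<close>
  just left of \<open>u\<close> and points to the left.  Raising the ray by one half keeps it off the vertices of
  the walk.  This is the mod-2 winding number of the Jordan curve theorem: as long as \<open>u\<close> stays in rows between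
  those of the two ends of the walk, it does not change when \<open>u\<close> moves through sites off the walk.\<close>

definition crossings_left_of :: "site list \<Rightarrow> site \<Rightarrow> bool" where
  "crossings_left_of xs u \<longleftrightarrow>
     odd_steps (\<lambda>a b. fst a < fst u \<and> fst b < fst u \<and> (snd a \<le> snd u) \<noteq> (snd b \<le> snd u)) xs"

lemma crossings_left_of_right:
  assumes "lattice_walk xs" "(x, y) \<notin> set xs"
  shows "crossings_left_of xs (x + 1, y) = crossings_left_of xs (x, y)"
  unfolding crossings_left_of_def
proof (rule odd_steps_cong, rule successively_mono[OF successively_conj_set[OF assms(1)]])
  fix a b assume *: "L1_dist a b = 1 \<and> a \<in> set xs \<and> b \<in> set xs"
  with assms(2) have "a \<noteq> (x, y)" "b \<noteq> (x, y)" by auto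
  with * show "(fst a < fst (x + 1, y) \<and> fst b < fst (x + 1, y) \<and> (snd a \<le> snd (x + 1, y)) \<noteq> (snd b \<le> snd (x + 1, y))) =
    (fst a < fst (x, y) \<and> fst b < fst (x, y) \<and> (snd a \<le> snd (x, y)) \<noteq> (snd b \<le> snd (x, y)))"
    by (cases a, cases b) (auto simp: L1_dist_def)
qed

text \<open>A step crosses exactly one of the two rays when it enters or leaves the part of row \<open>y + 1\<close> left of
  \<open>x\<close>.  The walk starts and ends outside this row, so the number of such steps is even.\<close>

lemma crossings_left_of_up:
  assumes "lattice_walk xs" "xs \<noteq> []" "(x, y + 1) \<notin> set xs"
    and "snd (hd xs) \<le> y" "y + 1 < snd (last xs)"
  shows "crossings_left_of xs (x, y + 1) = crossings_left_of xs (x, y)"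
  unfolding crossings_left_of_def
proof (rule odd_steps_cong_if_xor_telescopes[where g = "\<lambda>v. snd v = y + 1 \<and> fst v < x"],
       rule successively_mono[OF successively_conj_set[OF assms(1)]])
  fix a b assume *: "L1_dist a b = 1 \<and> a \<in> set xs \<and> b \<in> set xs"
  with assms(3) have "a \<noteq> (x, y + 1)" "b \<noteq> (x, y + 1)" by auto
  with * show "((fst a < fst (x, y + 1) \<and> fst b < fst (x, y + 1) \<and> (snd a \<le> snd (x, y + 1)) \<noteq> (snd b \<le> snd (x, y + 1))) \<noteq>
    (fst a < fst (x, y) \<and> fst b < fst (x, y) \<and> (snd a \<le> snd (x, y)) \<noteq> (snd b \<le> snd (x, y)))) \<longleftrightarrow>
    (snd a = y + 1 \<and> fst a < x) \<noteq> (snd b = y + 1 \<and> fst b < x)"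
    by (cases a, cases b) (auto simp: L1_dist_def)
qed (use assms in auto)

text \<open>If the walks were disjoint, \<open>crossings_left_of xs\<close> would be constant along \<open>ys\<close>.  But at the left end
  of \<open>ys\<close> the ray misses \<open>xs\<close>, and at the right end it sees all steps of \<open>xs\<close> between two adjacent
  rows, an odd number since \<open>xs\<close> goes from below to above.\<close>

lemma crossing_walks_meet:
  assumes "lattice_walk xs" "xs \<noteq> []" "lattice_walk ys" "ys \<noteq> []"
    and "fst ` set xs \<subseteq> {x0..x1}" "snd (hd xs) < y0" "y1 < snd (last xs)"
    and "snd ` set ys \<subseteq> {y0..y1}" "fst (hd ys) < x0" "x1 < fst (last ys)"
  shows "set xs \<inter> set ys \<noteq> {}"
proof
  assume disj: "set xs \<inter> set ys = {}"
  have "successively (\<lambda>u v. crossings_left_of xs u = crossings_left_of xs v) ys"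
  proof (rule successively_mono[OF successively_conj_set[OF assms(3)]])
    fix u v assume *: "L1_dist u v = 1 \<and> u \<in> set ys \<and> v \<in> set ys"
    obtain x y where u: "u = (x, y)" by (cases u)
    have nin: "u \<notin> set xs" "v \<notin> set xs" using * disj by auto
    have rows: "y0 \<le> snd u" "snd u \<le> y1" "y0 \<le> snd v" "snd v \<le> y1" using * assms(8) by auto
    have "v = (x + 1, y) \<or> v = ((x - 1), y) \<or> v = (x, y + 1) \<or> v = (x, y - 1)"
      using * u by (cases v) (auto simp: L1_dist_def)
    then show "crossings_left_of xs u = crossings_left_of xs v"
    proof (elim disjE)
      assume "v = (x + 1, y)" then show ?thesis
        using crossings_left_of_right[OF assms(1), of x y] nin u by simp
    next
      assume "v = (x - 1, y)" then show ?thesis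
        using crossings_left_of_right[OF assms(1), of "x - 1" y] nin u by simp
    next
      assume v: "v = (x, y + 1)"
      show ?thesis unfolding u v
        by (rule crossings_left_of_up[OF assms(1,2), symmetric]) (use v u rows nin assms in auto)
    next
      assume v: "v = (x, y - 1)"
      show ?thesis unfolding u v
        using crossings_left_of_up[OF assms(1,2), of x "y - 1"] v u rows nin assms by auto
    qed
  qed
  then have "crossings_left_of xs (last ys) = crossings_left_of xs (hd ys)"
    using successively_imp_all_eq_hd[of _ ys "last ys"] assms(4) by (metis last_in_set)
  moreover have "\<not> crossings_left_of xs (hd ys)"
  proof -
    have "crossings_left_of xs (hd ys) \<longleftrightarrow> odd_steps (\<lambda>a b. False) xs"
      unfolding crossings_left_of_def
      by (rule odd_steps_cong, rule successively_mono[OF successively_conj_set[OF assms(1)]])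
         (use assms(5,9) in force)
    also have "\<dots> \<longleftrightarrow> False"
      using odd_steps_telescope[of "\<lambda>_ _. False" "\<lambda>_. False" xs] assms(2)
      by (simp add: successively_mono[OF assms(1)])
    finally show ?thesis by simp
  qed
  moreover have "crossings_left_of xs (last ys)"
  proof -
    have "crossings_left_of xs (last ys) \<longleftrightarrow>
        (snd (hd xs) \<le> snd (last ys)) \<noteq> (snd (last xs) \<le> snd (last ys))"
      unfolding crossings_left_of_def
      by (rule odd_steps_telescope, rule successively_mono[OF successively_conj_set[OF assms(1)]])
         (use assms(2,5,10) in force)+
    moreover have "y0 \<le> snd (last ys)" "snd (last ys) \<le> y1"
      using assms(4,8) last_in_set[of ys] by fastforce+
    ultimately show ?thesis using assms(6,7) by auto
  qed
  ultimately show False by simp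
qed

section \<open>Dual paths that block a crossing of a rectangle\<close>

abbreviation rect :: "int \<Rightarrow> int \<Rightarrow> int \<Rightarrow> int \<Rightarrow> site set" where
  "rect x0 x1 y0 y1 \<equiv> {x0..x1} \<times> {y0..y1}"

lemma edge_lattice_graph_on_iff:
  "{u, v} \<in> edges (lattice_graph_on V) \<longleftrightarrow> u \<in> V \<and> v \<in> V \<and> L1_dist u v = 1"
  by (cases u; cases v) (auto simp: lattice_graph_on_def doubleton_eq_iff L1_dist_def)

definition open_walk :: "(site set \<Rightarrow> bool) \<Rightarrow> site set \<Rightarrow> site list \<Rightarrow> bool" where
  "open_walk \<eta> V xs \<longleftrightarrow> xs \<noteq> [] \<and> set xs \<subseteq> V \<and>
     successively (\<lambda>u v. {u, v} \<in> edges (lattice_graph_on V) \<and> \<eta> {u, v}) xs"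

lemma open_walk_lattice_walk: "open_walk \<eta> V xs \<Longrightarrow> lattice_walk xs"
  unfolding open_walk_def
  by (auto elim: successively_mono simp: edge_lattice_graph_on_iff)

lemma rtrancl_imp_distinct_walk:
  assumes "(x, y) \<in> r\<^sup>*"
  shows "\<exists>xs. xs \<noteq> [] \<and> hd xs = x \<and> last xs = y \<and> distinct xs \<and> successively (\<lambda>a b. (a, b) \<in> r) xs"
  using assms
proof (induction rule: rtrancl_induct)
  case base
  show ?case by (rule exI[of _ "[x]"]) simp
next
  case (step y z)
  then obtain xs where xs: "xs \<noteq> []" "hd xs = x" "last xs = y" "distinct xs"
    "successively (\<lambda>a b. (a, b) \<in> r) xs" by blast
  show ?case
  proof (cases "z \<in> set xs")
    case True
    then obtain us vs where "xs = (us @ [z]) @ vs" by (metis append_Cons append_assoc self_append_conv2 split_list)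
    with xs show ?thesis
      by (intro exI[of _ "us @ [z]"]) (auto simp: successively_append_iff hd_append split: if_splits)
  next
    case False
    with xs step(2) show ?thesis
      by (intro exI[of _ "xs @ [z]"]) (auto simp: successively_append_iff)
  qed
qed

text \<open>Faces of the lattice are named by their lower left corner: the face \<open>(i, j)\<close> is the unit square
  \<open>[i, i + 1] \<times> [j, j + 1]\<close>, so faces are again indexed by \<^typ>\<open>site\<close>, and dual paths are lattice walks of
  faces.  This is the edge between two adjacent faces.\<close>

definition crossed_edge :: "site \<Rightarrow> site \<Rightarrow> site set" where
  "crossed_edge f g = {(max (fst f) (fst g), max (snd f) (snd g)),
                       (min (fst f) (fst g) + 1, min (snd f) (snd g) + 1)}"

lemma crossed_edge_commute: "crossed_edge f g = crossed_edge g f"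
  by (simp add: crossed_edge_def max.commute min.commute)

lemma crossed_edge_up: "crossed_edge (i, j - 1) (i, j) = {(i, j), (i + 1, j)}"
  and crossed_edge_right: "crossed_edge (i - 1, j) (i, j) = {(i, j), (i, j + 1)}"
  by (auto simp: crossed_edge_def)

text \<open>Coordinatewise, the two ends of the edge add up to the sum of the two faces plus one, and two
  adjacent faces are determined by their sum.\<close>

lemma crossed_edge_inj:
  assumes "L1_dist f g = 1" "L1_dist f' g' = 1" "crossed_edge f g = crossed_edge f' g'"
  shows "{f, g} = {f', g'}"
proof -
  obtain a b c d where fg: "f = (a, b)" "g = (c, d)" by (cases f; cases g)
  obtain a' b' c' d' where fg': "f' = (a', b')" "g' = (c', d')" by (cases f'; cases g')
  have "max a c + (min a c + 1) = max a' c' + (min a' c' + 1)"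
    "max b d + (min b d + 1) = max b' d' + (min b' d' + 1)"
    using assms(3) unfolding crossed_edge_def fg fg' doubleton_eq_iff by auto
  then have "a + c = a' + c'" "b + d = b' + d'" by linarith+
  moreover have "c = a + 1 \<and> d = b \<or> c = a - 1 \<and> d = b \<or> c = a \<and> d = b + 1 \<or> c = a \<and> d = b - 1"
    using assms(1) unfolding L1_dist_def fg by auto
  moreover have "c' = a' + 1 \<and> d' = b' \<or> c' = a' - 1 \<and> d' = b' \<or> c' = a' \<and> d' = b' + 1 \<or> c' = a' \<and> d' = b' - 1"
    using assms(2) unfolding L1_dist_def fg' by auto
  ultimately have "a = a' \<and> b = b' \<and> c = c' \<and> d = d' \<or> a = c' \<and> b = d' \<and> c = a' \<and> d = b'"
    by (elim disjE conjE; hypsubst; presburger)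
  then show ?thesis unfolding fg fg' by auto
qed

definition crossed_edges :: "site list \<Rightarrow> site set set" where
  "crossed_edges fs = (\<lambda>t. crossed_edge (fs ! t) (fs ! Suc t)) ` {..<length fs - 1}"

lemma card_crossed_edges:
  assumes "lattice_walk fs" "distinct fs"
  shows "card (crossed_edges fs) = length fs - 1"
proof -
  have "inj_on (\<lambda>t. crossed_edge (fs ! t) (fs ! Suc t)) {..<length fs - 1}"
  proof (rule inj_onI)
    fix t t' assume t: "t \<in> {..<length fs - 1}" "t' \<in> {..<length fs - 1}"
      and eq: "crossed_edge (fs ! t) (fs ! Suc t) = crossed_edge (fs ! t') (fs ! Suc t')"
    have "{fs ! t, fs ! Suc t} = {fs ! t', fs ! Suc t'}"
      by (rule crossed_edge_inj[OF _ _ eq]) (use t assms(1) in \<open>auto intro: successively_nth\<close>)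
    then show "t = t'"
      using t assms(2) by (auto simp: doubleton_eq_iff nth_eq_iff_index_eq)
  qed
  then show ?thesis by (simp add: crossed_edges_def card_image)
qed

lemma card_lattice_walks:
  assumes "finite S"
  shows "finite {fs. lattice_walk fs \<and> length fs = Suc m \<and> hd fs \<in> S}" (is "finite (?W m)")
    and "card {fs. lattice_walk fs \<and> length fs = Suc m \<and> hd fs \<in> S} \<le> card S * 4 ^ m"
proof (induction m)
  case 0
  have eq: "?W 0 = (\<lambda>f. [f]) ` S" by (auto simp: length_Suc_conv)
  show "finite (?W 0)" using assms by (simp only: eq finite_imageI)
  show "card (?W 0) \<le> card S * 4 ^ 0" using card_image_le[OF assms, of "\<lambda>f. [f]"] by (simp add: eq)
next
  case (Suc m)
  define D :: "site set" where "D = {(1, 0), (-1, 0), (0, 1), (0, -1)}"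
  let ?ext = "\<lambda>(fs, d). fs @ [last fs + d]"
  have sub: "?W (Suc m) \<subseteq> ?ext ` (?W m \<times> D)"
  proof
    fix fs assume fs: "fs \<in> ?W (Suc m)"
    then obtain gs g where gs: "fs = gs @ [g]" "gs \<noteq> []"
      by (cases fs rule: rev_cases) (simp, force)
    then have "g - last gs \<in> D"
      using fs by (cases g; cases "last gs") (auto simp: D_def successively_append_iff L1_dist_def)
    moreover have "gs \<in> ?W m" using fs gs by (auto simp: successively_append_iff hd_append)
    ultimately show "fs \<in> ?ext ` (?W m \<times> D)"
      using gs by (intro image_eqI[where x = "(gs, g - last gs)"]) auto
  qed
  have fin: "finite (?W m \<times> D)" using Suc by (auto simp: D_def)
  show "finite (?W (Suc m))" by (rule finite_subset[OF sub finite_imageI[OF fin]])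
  have "card (?W (Suc m)) \<le> card (?W m \<times> D)"
    using card_mono[OF finite_imageI[OF fin] sub] card_image_le[OF fin, of ?ext] by linarith
  also have "\<dots> = card (?W m) * 4" by (simp add: card_cartesian_product D_def)
  also have "\<dots> \<le> card S * 4 ^ Suc m" using Suc(2) by simp
  finally show "card (?W (Suc m)) \<le> card S * 4 ^ Suc m" .
qed

lemma successively_upto:
  assumes "\<And>i. a \<le> i \<Longrightarrow> i < b \<Longrightarrow> P i (i + 1)"
  shows "successively P [a..b]"
  unfolding successively_conv_nth
proof (intro allI impI)
  fix k assume "Suc k < length [a..b]"
  then have k: "a + int k < b" by auto
  then have "[a..b] ! k = a + int k" "[a..b] ! Suc k = a + int k + 1" by (auto simp: nth_upto)
  with k show "P ([a..b] ! k) ([a..b] ! Suc k)" using assms[of "a + int k"] by (simp only:)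
qed

text \<open>The edges crossed by the dual relation \<open>D\<close> are those that leave \<open>A\<close>.  The boundary of a
  face is a cycle, so it meets this cut in an even number of edges, and every face inside the
  rectangle has even degree in \<open>D\<close>.  Let \<open>K\<close> be the set of faces that can be reached from below the
  rectangle.  Summing the degrees over the faces of \<open>K\<close> in one row shows that the number of cut edges
  crossed vertically by \<open>K\<close> has the same parity in all rows of sites.  In the bottom row all cut
  edges count, and their number is odd because the left end is in \<open>A\<close> and the right end is not.  So
  \<open>K\<close> also crosses the top row.\<close>

lemma separated_rectangle_has_dual_path:
  fixes A :: "site set"
  assumes "x0 < x1" "y0 \<le> y1"
    and left: "{x0} \<times> {y0..y1} \<subseteq> A" and right: "({x1} \<times> {y0..y1}) \<inter> A = {}"
    and D: "D = {(f, g). L1_dist f g = 1 \<and> (\<exists>u v. crossed_edge f g = {u, v} \<and>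
                  {u, v} \<in> edges (lattice_graph_on (rect x0 x1 y0 y1)) \<and> u \<in> A \<and> v \<notin> A)}"
  shows "\<exists>i\<in>{x0..<x1}. \<exists>i'. ((i, y0 - 1), (i', y1)) \<in> D\<^sup>*"
proof -
  define K where "K = {f. \<exists>i\<in>{x0..<x1}. ((i, y0 - 1), f) \<in> D\<^sup>*}"
  have D_commute: "(f, g) \<in> D \<longleftrightarrow> (g, f) \<in> D" for f g
    by (simp add: D crossed_edge_commute[of f g]) (auto simp: L1_dist_def)
  have K_cong: "f \<in> K \<longleftrightarrow> g \<in> K" if "(f, g) \<in> D" for f g
    using that D_commute unfolding K_def by (blast intro: rtrancl_into_rtrancl)
  have cut: "(f, g) \<in> D" if "L1_dist f g = 1" "crossed_edge f g = {u, v}" "u \<in> rect x0 x1 y0 y1"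
      "v \<in> rect x0 x1 y0 y1" "L1_dist u v = 1" "(u \<in> A) \<noteq> (v \<in> A)" for f g u v
  proof (cases "u \<in> A")
    case True
    with that show ?thesis unfolding D edge_lattice_graph_on_iff by blast
  next
    case False
    have "crossed_edge f g = {v, u}" "L1_dist v u = 1" using that by (auto simp: L1_dist_def)
    with that False show ?thesis unfolding D edge_lattice_graph_on_iff by blast
  qed
  have cut_up: "((i, j - 1), (i, j)) \<in> D"
    if "x0 \<le> i" "i < x1" "y0 \<le> j" "j \<le> y1" "((i, j) \<in> A) \<noteq> ((i + 1, j) \<in> A)" for i j
    by (rule cut[OF _ crossed_edge_up]) (use that in \<open>auto simp: L1_dist_def\<close>)
  have cut_right: "((i - 1, j), (i, j)) \<in> D"
    if "x0 \<le> i" "i \<le> x1" "y0 \<le> j" "j < y1" "((i, j) \<in> A) \<noteq> ((i, j + 1) \<in> A)" for i j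
    by (rule cut[OF _ crossed_edge_right]) (use that in \<open>auto simp: L1_dist_def\<close>)
  define N where "N j = odd_steps (\<lambda>i i'. (((i, j) \<in> A) \<noteq> ((i', j) \<in> A)) \<and> (i, j - 1) \<in> K) [x0..x1]" for j
  have ends: "[x0..x1] \<noteq> []" "hd [x0..x1] = x0" "last [x0..x1] = x1"
    using assms(1) by (auto simp: last_conv_nth hd_conv_nth)
  \<comment> \<open>The steps that distinguish \<open>N j\<close> from \<open>N (j + 1)\<close> are the faces of \<open>K\<close> in row \<open>j\<close> for which
    exactly one of the two vertical sides is cut.  As \<open>K\<close> is closed under \<open>D\<close>, they are the changes
    along the row of the predicate that says that the left side of the face is cut and the face is
    in \<open>K\<close>, a predicate that is false at both ends.\<close>
  have N_step: "N j \<longleftrightarrow> N (j + 1)" if "y0 \<le> j" "j < y1" for j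
    unfolding N_def
  proof (rule odd_steps_cong_if_xor_telescopes[where
        g = "\<lambda>i. (((i, j) \<in> A) \<noteq> ((i, j + 1) \<in> A)) \<and> (i, j) \<in> K"], rule successively_upto)
    fix i assume i: "x0 \<le> i" "i < x1"
    have "((i, j) \<in> A) \<noteq> ((i + 1, j) \<in> A) \<Longrightarrow> (i, j - 1) \<in> K \<longleftrightarrow> (i, j) \<in> K"
      using cut_up[of i j] K_cong that i by auto
    moreover have "((i + 1, j) \<in> A) \<noteq> ((i + 1, j + 1) \<in> A) \<Longrightarrow> (i, j) \<in> K \<longleftrightarrow> (i + 1, j) \<in> K"
      using cut_right[of "i + 1" j] K_cong that i by auto
    ultimately show "((((i, j) \<in> A) \<noteq> ((i + 1, j) \<in> A) \<and> (i, j - 1) \<in> K) \<noteq>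
          (((i, j + 1) \<in> A) \<noteq> ((i + 1, j + 1) \<in> A) \<and> (i, j + 1 - 1) \<in> K)) \<longleftrightarrow>
         (((i, j) \<in> A) \<noteq> ((i, j + 1) \<in> A) \<and> (i, j) \<in> K) \<noteq>
         (((i + 1, j) \<in> A) \<noteq> ((i + 1, j + 1) \<in> A) \<and> (i + 1, j) \<in> K)"
      by (simp only: add_diff_cancel_right') blast
  next
    show "[x0..x1] \<noteq> []" by (rule ends)
    have "(x1, j) \<in> {x1} \<times> {y0..y1}" "(x1, j + 1) \<in> {x1} \<times> {y0..y1}" using that by auto
    then have "(x0, j) \<in> A" "(x0, j + 1) \<in> A" "(x1, j) \<notin> A" "(x1, j + 1) \<notin> A"
      using left right that by (auto simp del: mem_Sigma_iff)
    then show "((hd [x0..x1], j) \<in> A) \<noteq> ((hd [x0..x1], j + 1) \<in> A) \<and> (hd [x0..x1], j) \<in> K \<longleftrightarrow>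
        ((last [x0..x1], j) \<in> A) \<noteq> ((last [x0..x1], j + 1) \<in> A) \<and> (last [x0..x1], j) \<in> K"
      by (simp add: ends)
  qed
  have N_bottom: "N y0"
  proof -
    have "N y0 \<longleftrightarrow> ((hd [x0..x1], y0) \<in> A) \<noteq> ((last [x0..x1], y0) \<in> A)"
      unfolding N_def
    proof (rule odd_steps_telescope[OF _ ends(1)], rule successively_upto)
      fix i assume "x0 \<le> i" "i < x1"
      then have "(i, y0 - 1) \<in> K" unfolding K_def by auto
      then show "(((i, y0) \<in> A) \<noteq> ((i + 1, y0) \<in> A) \<and> (i, y0 - 1) \<in> K) \<longleftrightarrow>
           ((i, y0) \<in> A) \<noteq> ((i + 1, y0) \<in> A)" by simp
    qed
    moreover have "(x0, y0) \<in> A" "(x1, y0) \<notin> A" using left right assms(2) by (auto dest: equals0D[of _ "(x1, y0)"])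
    ultimately show ?thesis by (simp add: ends)
  qed
  have "j \<le> y1 \<longrightarrow> N j" if "y0 \<le> j" for j
    using that
  proof (induction j rule: int_ge_induct)
    case base show ?case using N_bottom by simp
  next
    case (step j)
    then show ?case using N_step[of j] by simp
  qed
  then have "N y1" using assms(2) by simp
  then obtain i i' where i: "i \<in> set [x0..x1]" "i' \<in> set [x0..x1]" "i' = i + 1"
    "((i, y1) \<in> A) \<noteq> ((i', y1) \<in> A)" "(i, y1 - 1) \<in> K"
    using odd_steps_imp_step[of _ "[x0..x1]" "\<lambda>i i'. i' = i + 1"] successively_upto[of x0 x1 "\<lambda>i i'. i' = i + 1"]
    unfolding N_def by blast
  then have "(i, y1) \<in> K"
    using cut_up[of i y1] K_cong assms(2) by auto
  then show ?thesis unfolding K_def by blast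
qed

text \<open>The blockers are the sets of edges crossed by the dual paths with \<open>Suc h\<close> steps that start below
  the rectangle, repeat no face and only cross edges of the rectangle.  If no open walk crosses, take
  \<open>A\<close> to be what is connected to the left side: a dual path through closed edges climbs from below
  the rectangle to above it, and the edges crossed by its first \<open>Suc h\<close> steps form a blocker without
  open edges.  A dual path without repeated faces crosses distinct edges, hence the exact
  cardinality.\<close>

lemma crossing_blockers:
  assumes "x0 < x1" and wh: "y1 = y0 + int h"
  obtains \<F> :: "site set set set" where
    "finite \<F>" "card \<F> \<le> nat (x1 - x0) * 4 ^ Suc h"
    "\<And>F. F \<in> \<F> \<Longrightarrow> F \<subseteq> edges (lattice_graph_on (rect x0 x1 y0 y1)) \<and> finite F \<and> card F = Suc h"
    "\<And>\<eta>. (\<And>F. F \<in> \<F> \<Longrightarrow> \<exists>e\<in>F. \<eta> e) \<Longrightarrow>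
        \<exists>xs. open_walk \<eta> (rect x0 x1 y0 y1) xs \<and> fst (hd xs) = x0 \<and> fst (last xs) = x1"
proof
  let ?R = "rect x0 x1 y0 y1"
  define S where "S = {x0..<x1} \<times> {y0 - 1}"
  define W where "W = {fs. lattice_walk fs \<and> length fs = Suc (Suc h) \<and> hd fs \<in> S}"
  define \<F> where "\<F> = crossed_edges ` {fs \<in> W. distinct fs \<and> crossed_edges fs \<subseteq> edges (lattice_graph_on ?R)}"
  have S: "finite S" "card S = nat (x1 - x0)" by (auto simp: S_def card_cartesian_product)
  have W: "finite W" "card W \<le> nat (x1 - x0) * 4 ^ Suc h"
    using card_lattice_walks[OF S(1), of "Suc h"] S(2) by (auto simp: W_def)
  show "finite \<F>" using W by (simp add: \<F>_def)
  have "card \<F> \<le> card {fs \<in> W. distinct fs \<and> crossed_edges fs \<subseteq> edges (lattice_graph_on ?R)}"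
    unfolding \<F>_def by (rule card_image_le) (use W in auto)
  also have "\<dots> \<le> card W" by (rule card_mono) (use W in auto)
  finally show "card \<F> \<le> nat (x1 - x0) * 4 ^ Suc h" using W(2) by linarith
  show "F \<subseteq> edges (lattice_graph_on ?R) \<and> finite F \<and> card F = Suc h" if "F \<in> \<F>" for F
    using that unfolding \<F>_def W_def by (auto simp: card_crossed_edges) (simp add: crossed_edges_def)
  fix \<eta> assume unblocked: "\<And>F. F \<in> \<F> \<Longrightarrow> \<exists>e\<in>F. \<eta> e"
  define E where "E = {(u, v). {u, v} \<in> edges (lattice_graph_on ?R) \<and> \<eta> {u, v}}"
  define A where "A = {v. \<exists>u\<in>{x0} \<times> {y0..y1}. (u, v) \<in> E\<^sup>*}"
  show "\<exists>xs. open_walk \<eta> ?R xs \<and> fst (hd xs) = x0 \<and> fst (last xs) = x1"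
  proof (cases "({x1} \<times> {y0..y1}) \<inter> A = {}")
    case False
    then obtain u v where uv: "u \<in> {x0} \<times> {y0..y1}" "v \<in> {x1} \<times> {y0..y1}" "(u, v) \<in> E\<^sup>*"
      unfolding A_def by blast
    obtain xs where xs: "xs \<noteq> []" "hd xs = u" "last xs = v" "successively (\<lambda>a b. (a, b) \<in> E) xs"
      using rtrancl_imp_distinct_walk[OF uv(3)] by blast
    have "set xs \<subseteq> ?R"
    proof -
      have "set xs \<subseteq> insert (hd xs) ?R" using xs(4)
        by (induction xs rule: induct_list012) (auto simp: E_def edge_lattice_graph_on_iff)
      then show ?thesis using xs(2) uv(1) assms by auto
    qed
    then show ?thesis using xs uv by (intro exI[of _ xs]) (auto simp: open_walk_def E_def)
  next
    case True
    define D where "D = {(f, g). L1_dist f g = 1 \<and> (\<exists>u v. crossed_edge f g = {u, v} \<and>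
                  {u, v} \<in> edges (lattice_graph_on ?R) \<and> u \<in> A \<and> v \<notin> A)}"
    have "{x0} \<times> {y0..y1} \<subseteq> A" unfolding A_def by blast
    then obtain i i' where i: "i \<in> {x0..<x1}" "((i, y0 - 1), (i', y1)) \<in> D\<^sup>*"
      using separated_rectangle_has_dual_path[OF assms(1) _ _ True D_def] wh by auto
    obtain fs where fs: "fs \<noteq> []" "hd fs = (i, y0 - 1)" "last fs = (i', y1)" "distinct fs"
      "successively (\<lambda>a b. (a, b) \<in> D) fs"
      using rtrancl_imp_distinct_walk[OF i(2)] by blast
    have walk: "lattice_walk fs" using fs(5) by (rule successively_mono) (auto simp: D_def)
    have "snd (fs ! t) \<le> snd (fs ! 0) + int t" if "t < length fs" for t
      using that
    proof (induction t)
      case (Suc t)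
      have "L1_dist (fs ! t) (fs ! Suc t) = 1" using walk Suc by (auto intro: successively_nth)
      with Suc show ?case by (auto simp: L1_dist_def)
    qed auto
    \<comment> \<open>Each step changes the row by at most one, and the path climbs \<open>h + 1\<close> rows.\<close>
    from this[of "length fs - 1"] have len: "Suc (Suc h) \<le> length fs"
      using fs(1-3) wh by (auto simp: hd_conv_nth last_conv_nth)
    define gs where "gs = take (Suc (Suc h)) fs"
    have D_gs: "(gs ! t, gs ! Suc t) \<in> D" if "t < Suc h" for t
      using that len fs(5) by (auto simp: gs_def intro: successively_nth)
    have len_gs: "length gs = Suc (Suc h)" using len by (simp add: gs_def)
    have closed: "e \<in> edges (lattice_graph_on ?R) \<and> \<not> \<eta> e" if e: "e \<in> crossed_edges gs" for e
    proof -
      obtain t where t: "t < Suc h" "e = crossed_edge (gs ! t) (gs ! Suc t)"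
        using e len_gs by (auto simp: crossed_edges_def)
      obtain u v where uv: "e = {u, v}" "{u, v} \<in> edges (lattice_graph_on ?R)" "u \<in> A" "v \<notin> A"
        using D_gs[OF t(1)] t(2) unfolding D_def by blast
      then have "(u, v) \<notin> E" unfolding A_def by (blast intro: rtrancl_into_rtrancl)
      with uv show ?thesis by (simp add: E_def)
    qed
    have "lattice_walk gs" unfolding gs_def
      using walk successively_append_iff[of _ "take (Suc (Suc h)) fs" "drop (Suc (Suc h)) fs"] by simp
    moreover have "hd gs \<in> S" using fs(1,2) i(1) by (simp add: gs_def S_def)
    moreover have "distinct gs" using fs(4) by (simp add: gs_def)
    ultimately have "crossed_edges gs \<in> \<F>"
      using len_gs closed unfolding \<F>_def W_def by auto
    then show ?thesis using unblocked closed by blast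
  qed
qed

section \<open>Borel--Cantelli for bond percolation\<close>

text \<open>A fixed set of \<open>m n\<close> edges is entirely removed with probability \<open>(1 - p) ^ m n\<close>; the union bound and
  the Borel--Cantelli lemma do the rest.\<close>

lemma AE_bond_percolation_eventually_hits:
  fixes \<F> :: "nat \<Rightarrow> 'a set set set"
  assumes p: "0 \<le> p" "p \<le> 1"
    and \<F>: "\<And>n. finite (\<F> n)" "\<And>n. real (card (\<F> n)) \<le> c n"
      "\<And>n F. F \<in> \<F> n \<Longrightarrow> F \<subseteq> edges G \<and> finite F \<and> card F = m n"
    and summable: "summable (\<lambda>n. c n * (1 - p) ^ m n)"
  shows "AE \<eta> in bond_percolation G p. \<forall>\<^sub>F n in sequentially. \<forall>F\<in>\<F> n. \<exists>e\<in>F. \<eta> e"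
proof -
  interpret P: product_prob_space "\<lambda>_. measure_pmf (bernoulli_pmf p)" "edges G"
    by unfold_locales
  let ?M = "bond_percolation G p"
  have M: "?M = PiM (edges G) (\<lambda>_. measure_pmf (bernoulli_pmf p))" by (simp add: bond_percolation_def)
  interpret M: prob_space ?M unfolding M by (rule P.P.prob_space_axioms)
  define closed where "closed F = {\<eta> \<in> space ?M. \<forall>e\<in>F. \<eta> e \<in> {False}}" for F
  have closed: "closed F \<in> sets ?M" "measure ?M (closed F) = (1 - p) ^ m n" if "F \<in> \<F> n" for F n
  proof -
    have F: "F \<subseteq> edges G" "finite F" "card F = m n" using \<F>(3)[OF that] by auto
    have emb: "{\<eta> \<in> space ?M. \<forall>e\<in>F. \<eta> e \<in> X e} =
        prod_emb (edges G) (\<lambda>_. measure_pmf (bernoulli_pmf p)) F (Pi\<^sub>E F X)" for X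
      using F(1) unfolding M by (auto simp: prod_emb_def space_PiM restrict_PiE_iff)
    have "prod_emb (edges G) (\<lambda>_. measure_pmf (bernoulli_pmf p)) F (Pi\<^sub>E F (\<lambda>_. {False})) \<in> sets ?M"
      unfolding M by (rule sets_PiM_I) (use F in simp_all)
    then show "closed F \<in> sets ?M" unfolding closed_def emb .
    have "emeasure ?M (closed F) = (\<Prod>e\<in>F. emeasure (measure_pmf (bernoulli_pmf p)) {False})"
      unfolding closed_def M by (rule P.emeasure_PiM_Collect) (use F in auto)
    also have "\<dots> = ennreal ((1 - p) ^ m n)"
      using p F by (simp add: emeasure_pmf_single ennreal_power)
    finally show "measure ?M (closed F) = (1 - p) ^ m n"
      using p by (simp add: measure_def)
  qed
  have "AE \<eta> in ?M. \<forall>\<^sub>F n in sequentially. \<eta> \<in> space ?M - (\<Union>F\<in>\<F> n. closed F)"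
  proof (rule borel_cantelli_AE1)
    show "(\<Union>F\<in>\<F> n. closed F) \<in> sets ?M" for n using \<F>(1) closed(1) by blast
    show "emeasure ?M (\<Union>F\<in>\<F> n. closed F) < \<infinity>" for n
      by (simp add: M.emeasure_eq_measure)
    have "measure ?M (\<Union>F\<in>\<F> n. closed F) \<le> c n * (1 - p) ^ m n" for n
    proof -
      have "measure ?M (\<Union>F\<in>\<F> n. closed F) \<le> (\<Sum>F\<in>\<F> n. measure ?M (closed F))"
        using \<F>(1) closed(1) by (intro measure_UNION_le) auto
      also have "\<dots> = real (card (\<F> n)) * (1 - p) ^ m n" using closed(2) by simp
      also have "\<dots> \<le> c n * (1 - p) ^ m n" using \<F>(2) p by (intro mult_right_mono) auto
      finally show ?thesis .
    qed
    then show "summable (\<lambda>n. measure ?M (\<Union>F\<in>\<F> n. closed F))"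
      by (intro summable_comparison_test_ev[OF _ summable]) auto
  qed
  then show ?thesis
    by (rule AE_mp, intro AE_I2 impI) (auto elim!: eventually_mono simp: closed_def)
qed

section \<open>Bond percolation in a widening corridor\<close>

lemma edges_lattice_graph_on_mono: "V \<subseteq> W \<Longrightarrow> edges (lattice_graph_on V) \<subseteq> edges (lattice_graph_on W)"
  unfolding lattice_graph_on_def snd_conv by blast

lemma edge_swap_iff:
  "{prod.swap u, prod.swap v} \<in> edges (lattice_graph_on (prod.swap ` V)) \<longleftrightarrow>
   {u, v} \<in> edges (lattice_graph_on V)"
  by (auto simp: edge_lattice_graph_on_iff L1_dist_def inj_image_mem_iff algebra_simps)

lemma edges_swap:
  "edges (lattice_graph_on (prod.swap ` V)) = image prod.swap ` edges (lattice_graph_on V)"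
proof (intro set_eqI iffI)
  fix e assume "e \<in> edges (lattice_graph_on (prod.swap ` V))"
  then obtain u v where e: "e = {u, v}" "{u, v} \<in> edges (lattice_graph_on (prod.swap ` V))"
    unfolding lattice_graph_on_def snd_conv by blast
  then have "{prod.swap u, prod.swap v} \<in> edges (lattice_graph_on V)"
    using edge_swap_iff[of "prod.swap u" "prod.swap v" V] by simp
  with e show "e \<in> image prod.swap ` edges (lattice_graph_on V)"
    by (intro image_eqI[where x = "{prod.swap u, prod.swap v}"]) auto
next
  fix e assume "e \<in> image prod.swap ` edges (lattice_graph_on V)"
  then obtain u v where "e = {prod.swap u, prod.swap v}" "{u, v} \<in> edges (lattice_graph_on V)"
    unfolding lattice_graph_on_def snd_conv by blast
  then show "e \<in> edges (lattice_graph_on (prod.swap ` V))" by (simp add: edge_swap_iff)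
qed

lemma crossing_blockers_vertical:
  assumes "y0 < y1" and "x1 = x0 + int w"
  obtains \<F> :: "site set set set" where
    "finite \<F>" "card \<F> \<le> nat (y1 - y0) * 4 ^ Suc w"
    "\<And>F. F \<in> \<F> \<Longrightarrow> F \<subseteq> edges (lattice_graph_on (rect x0 x1 y0 y1)) \<and> finite F \<and> card F = Suc w"
    "\<And>\<eta>. (\<And>F. F \<in> \<F> \<Longrightarrow> \<exists>e\<in>F. \<eta> e) \<Longrightarrow>
        \<exists>xs. open_walk \<eta> (rect x0 x1 y0 y1) xs \<and> snd (hd xs) = y0 \<and> snd (last xs) = y1"
proof -
  obtain \<F> where \<F>: "finite \<F>" "card \<F> \<le> nat (y1 - y0) * 4 ^ Suc w"
    "\<And>F. F \<in> \<F> \<Longrightarrow> F \<subseteq> edges (lattice_graph_on (rect y0 y1 x0 x1)) \<and> finite F \<and> card F = Suc w"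
    "\<And>\<eta>. (\<And>F. F \<in> \<F> \<Longrightarrow> \<exists>e\<in>F. \<eta> e) \<Longrightarrow>
        \<exists>xs. open_walk \<eta> (rect y0 y1 x0 x1) xs \<and> fst (hd xs) = y0 \<and> fst (last xs) = y1"
    using crossing_blockers[OF assms] by metis
  let ?sw = "image prod.swap :: site set \<Rightarrow> site set"
  have R: "rect x0 x1 y0 y1 = prod.swap ` rect y0 y1 x0 x1" by (simp add: product_swap)
  have inj: "inj ?sw" by (rule injI) (simp add: inj_image_eq_iff)
  show thesis
  proof (rule that[of "image ?sw ` \<F>"])
    show "finite (image ?sw ` \<F>)" using \<F>(1) by simp
    show "card (image ?sw ` \<F>) \<le> nat (y1 - y0) * 4 ^ Suc w"
      using card_image_le[OF \<F>(1), of "image ?sw"] \<F>(2) by linarith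
    show "F \<subseteq> edges (lattice_graph_on (rect x0 x1 y0 y1)) \<and> finite F \<and> card F = Suc w"
      if "F \<in> image ?sw ` \<F>" for F
      using that \<F>(3) inj unfolding R edges_swap by (auto simp: card_image inj_on_subset)
    fix \<eta> assume hit: "\<And>F. F \<in> image ?sw ` \<F> \<Longrightarrow> \<exists>e\<in>F. \<eta> e"
    then obtain xs where xs: "open_walk (\<lambda>e. \<eta> (prod.swap ` e)) (rect y0 y1 x0 x1) xs"
      "fst (hd xs) = y0" "fst (last xs) = y1"
      using \<F>(4)[of "\<lambda>e. \<eta> (prod.swap ` e)"] by fastforce
    have "open_walk \<eta> (rect x0 x1 y0 y1) (map prod.swap xs)"
      using xs(1) unfolding open_walk_def R successively_map edge_swap_iff by auto
    with xs show "\<exists>xs. open_walk \<eta> (rect x0 x1 y0 y1) xs \<and> snd (hd xs) = y0 \<and> snd (last xs) = y1"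
      by (intro exI[of _ "map prod.swap xs"]) (auto simp: open_walk_def hd_map last_map)
  qed
qed

lemma successively_imp_connected:
  assumes "successively (\<lambda>u v. (u, v) \<in> r) xs" "sym r" "u \<in> set xs" "v \<in> set xs"
  shows "(u, v) \<in> r\<^sup>*"
proof -
  have "(hd xs, w) \<in> r\<^sup>*" if "w \<in> set xs" for w
    using assms(1) that
    by (induction xs rule: induct_list012) (auto intro: converse_rtrancl_into_rtrancl)
  then show ?thesis using assms(2-4) by (meson rtrancl_trans sym_rtrancl symD)
qed

definition long_rect :: "nat \<Rightarrow> int \<Rightarrow> int \<Rightarrow> int \<Rightarrow> site set" where
  "long_rect n s lo hi =
     (if even n then rect lo hi s (s + int (n\<^sup>2)) else rect s (s + int (n\<^sup>2)) lo hi)"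

text \<open>A chain of overlapping rectangles inside \<open>V\<close>, alternately horizontal and vertical.  The \<open>n\<close>-th one is
  \<open>n\<^sup>2\<close> wide and sticks out of both sides of its two neighbours, so that long crossings of consecutive
  rectangles meet.  Its length is at most exponential in \<open>(n + 1)\<^sup>2\<close>, hence in its width, which is
  what a Peierls argument can afford.  The last clause makes the chain leave every finite region.\<close>

definition corridor :: "site set \<Rightarrow> nat \<Rightarrow> (nat \<Rightarrow> int) \<Rightarrow> (nat \<Rightarrow> int) \<Rightarrow> (nat \<Rightarrow> int) \<Rightarrow> bool" where
  "corridor V N s lo hi \<longleftrightarrow> (\<forall>n\<ge>N.
     long_rect n (s n) (lo n) (hi n) \<subseteq> V \<and>
     lo n < s (Suc n) \<and> s (Suc n) + int ((Suc n)\<^sup>2) < hi n \<and>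
     lo (Suc n) < s n \<and> s n + int (n\<^sup>2) < hi (Suc n) \<and>
     hi n - lo n \<le> 8 * 2 ^ ((Suc n)\<^sup>2) \<and>
     (\<forall>c\<in>{s n..s n + int (n\<^sup>2)}. int n \<le> \<bar>c\<bar>))"

text \<open>At retention \<open>63 / 64\<close>, the \<open>n\<close>-th rectangle has no long open crossing with probability at most
  its length times \<open>(4 / 64) ^ Suc (n\<^sup>2)\<close>, which is summable.  So almost surely all but finitely many
  rectangles are crossed; consecutive crossings meet, and their union is an infinite cluster.\<close>

lemma p_c_bond_less_1_if_corridor:
  assumes "corridor V N s lo hi"
  shows "p_c_bond (lattice_graph_on V) < 1"
proof -
  define S where "S n = long_rect n (s n) (lo n) (hi n)" for n
  have sub: "S n \<subseteq> V"
    and next': "lo n < s (Suc n) \<and> s (Suc n) + int ((Suc n)\<^sup>2) < hi n"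
    and prev: "lo (Suc n) < s n \<and> s n + int (n\<^sup>2) < hi (Suc n)"
    and len: "hi n - lo n \<le> 8 * 2 ^ ((Suc n)\<^sup>2)"
    and far: "\<And>c. c \<in> {s n..s n + int (n\<^sup>2)} \<Longrightarrow> int n \<le> \<bar>c\<bar>" if "n \<ge> N" for n
    using assms that unfolding corridor_def S_def by blast+
  define crosses where "crosses \<eta> n xs \<longleftrightarrow> open_walk \<eta> (S n) xs \<and>
      (if even n then fst (hd xs) = lo n \<and> fst (last xs) = hi n
       else snd (hd xs) = lo n \<and> snd (last xs) = hi n)" for \<eta> n xs
  let ?G = "lattice_graph_on V"
  define blocks where "blocks n \<F> \<longleftrightarrow> finite \<F> \<and> card \<F> \<le> nat (hi n - lo n) * 4 ^ Suc (n\<^sup>2) \<and>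
      (\<forall>F\<in>\<F>. F \<subseteq> edges ?G \<and> finite F \<and> card F = Suc (n\<^sup>2)) \<and>
      (\<forall>\<eta>. (\<forall>F\<in>\<F>. \<exists>e\<in>F. \<eta> e) \<longrightarrow> (\<exists>xs. crosses \<eta> n xs))" for n \<F>
  have "\<exists>\<F>. blocks n \<F>" if "n \<ge> N" for n
  proof -
    have lt: "lo n < hi n" using next'[OF that] by linarith
    have E: "edges (lattice_graph_on (S n)) \<subseteq> edges ?G"
      using sub[OF that] by (rule edges_lattice_graph_on_mono)
    show ?thesis
    proof (cases "even n")
      case True
      then have S: "S n = rect (lo n) (hi n) (s n) (s n + int (n\<^sup>2))" by (simp add: S_def long_rect_def)
      obtain \<F> where \<F>: "finite \<F>" "card \<F> \<le> nat (hi n - lo n) * 4 ^ Suc (n\<^sup>2)"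
        "\<And>F. F \<in> \<F> \<Longrightarrow> F \<subseteq> edges (lattice_graph_on (S n)) \<and> finite F \<and> card F = Suc (n\<^sup>2)"
        "\<And>\<eta>. (\<And>F. F \<in> \<F> \<Longrightarrow> \<exists>e\<in>F. \<eta> e) \<Longrightarrow>
           \<exists>xs. open_walk \<eta> (S n) xs \<and> fst (hd xs) = lo n \<and> fst (last xs) = hi n"
        using crossing_blockers[OF lt refl, where ?y0.0 = "s n" and h = "n\<^sup>2"] unfolding S by metis
      then show ?thesis using E True unfolding crosses_def blocks_def by (intro exI[of _ \<F>]) (simp, blast)
    next
      case False
      then have S: "S n = rect (s n) (s n + int (n\<^sup>2)) (lo n) (hi n)" by (simp add: S_def long_rect_def)
      obtain \<F> where \<F>: "finite \<F>" "card \<F> \<le> nat (hi n - lo n) * 4 ^ Suc (n\<^sup>2)"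
        "\<And>F. F \<in> \<F> \<Longrightarrow> F \<subseteq> edges (lattice_graph_on (S n)) \<and> finite F \<and> card F = Suc (n\<^sup>2)"
        "\<And>\<eta>. (\<And>F. F \<in> \<F> \<Longrightarrow> \<exists>e\<in>F. \<eta> e) \<Longrightarrow>
           \<exists>xs. open_walk \<eta> (S n) xs \<and> snd (hd xs) = lo n \<and> snd (last xs) = hi n"
        using crossing_blockers_vertical[OF lt refl, where ?x0.0 = "s n" and w = "n\<^sup>2"] unfolding S by metis
      then show ?thesis using E False unfolding crosses_def blocks_def by (intro exI[of _ \<F>]) (simp, blast)
    qed
  qed
  then have "\<forall>n. \<exists>\<F>. n \<ge> N \<longrightarrow> blocks n \<F>" by blast
  from choice[OF this] obtain \<F> where blocks: "\<And>n. n \<ge> N \<Longrightarrow> blocks n (\<F> n)" by blast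
  have \<F>: "finite (\<F> n)" "card (\<F> n) \<le> nat (hi n - lo n) * 4 ^ Suc (n\<^sup>2)"
    "\<And>F. F \<in> \<F> n \<Longrightarrow> F \<subseteq> edges ?G \<and> finite F \<and> card F = Suc (n\<^sup>2)"
    "\<And>\<eta>. (\<And>F. F \<in> \<F> n \<Longrightarrow> \<exists>e\<in>F. \<eta> e) \<Longrightarrow> \<exists>xs. crosses \<eta> n xs" if "n \<ge> N" for n
    using blocks[OF that] unfolding blocks_def by blast+
  define \<F>' where "\<F>' n = (if n \<ge> N then \<F> n else {})" for n
  define p :: real where "p = 63 / 64"
  have "AE \<eta> in bond_percolation ?G p. \<forall>\<^sub>F n in sequentially. \<forall>F\<in>\<F>' n. \<exists>e\<in>F. \<eta> e"
  proof (rule AE_bond_percolation_eventually_hits)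
    show "0 \<le> p" "p \<le> 1" by (auto simp: p_def)
    show "finite (\<F>' n)" for n using \<F>(1) by (simp add: \<F>'_def)
    show "F \<subseteq> edges ?G \<and> finite F \<and> card F = Suc (n\<^sup>2)" if "F \<in> \<F>' n" for n F
      using that \<F>(3) by (auto simp: \<F>'_def split: if_splits)
    show "real (card (\<F>' n)) \<le> 8 * 2 ^ ((Suc n)\<^sup>2) * 4 ^ Suc (n\<^sup>2)" for n
    proof (cases "n \<ge> N")
      case True
      have "real (card (\<F> n)) \<le> real (nat (hi n - lo n)) * 4 ^ Suc (n\<^sup>2)"
        using of_nat_mono[OF \<F>(2)[OF True], where 'a = real] by simp
      also have "real (nat (hi n - lo n)) \<le> 8 * 2 ^ ((Suc n)\<^sup>2)"
      proof -
        have "real_of_int (hi n - lo n) \<le> real_of_int (8 * 2 ^ ((Suc n)\<^sup>2))"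
          using len[OF True] by (simp only: of_int_le_iff)
        moreover have "real (nat (hi n - lo n)) = real_of_int (hi n - lo n)"
          using next'[OF True] by (intro of_nat_nat) linarith
        ultimately show ?thesis by simp
      qed
      finally show ?thesis using True by (simp add: \<F>'_def)
    qed (simp add: \<F>'_def)
    show "summable (\<lambda>n. 8 * 2 ^ ((Suc n)\<^sup>2) * 4 ^ Suc (n\<^sup>2) * (1 - p) ^ Suc (n\<^sup>2))"
    proof (rule summable_comparison_test_ev)
      show "summable (\<lambda>n. 8 * (1 / 2) ^ n :: real)" by (intro summable_mult summable_geometric) auto
      have "norm (8 * 2 ^ ((Suc n)\<^sup>2) * 4 ^ Suc (n\<^sup>2) * (1 - p) ^ Suc (n\<^sup>2)) \<le> 8 * (1 / 2) ^ n" for n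
      proof -
        have e: "(Suc n)\<^sup>2 + n \<le> 4 * Suc (n\<^sup>2)"
          by (cases n) (auto simp: power2_eq_square)
        have "(2 :: real) ^ ((Suc n)\<^sup>2) * 2 ^ n \<le> 16 ^ Suc (n\<^sup>2)"
          using power_increasing[OF e, of "2 :: real"] by (simp add: power_add power_mult)
        then have "(2 :: real) ^ ((Suc n)\<^sup>2) * (1 / 16) ^ Suc (n\<^sup>2) \<le> (1 / 2) ^ n"
          by (simp add: power_one_over field_simps del: power_Suc)
        moreover have "(4 :: real) ^ Suc (n\<^sup>2) * (1 - p) ^ Suc (n\<^sup>2) = (1 / 16) ^ Suc (n\<^sup>2)"
          unfolding power_mult_distrib[symmetric] by (simp add: p_def)
        moreover have "0 \<le> 1 - p" by (simp add: p_def)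
        ultimately show ?thesis by (simp add: mult.assoc del: power_Suc)
      qed
      then show "\<forall>\<^sub>F n in sequentially. norm (8 * 2 ^ ((Suc n)\<^sup>2) * 4 ^ Suc (n\<^sup>2) * (1 - p) ^ Suc (n\<^sup>2)) \<le> 8 * (1 / 2) ^ n"
        by (rule always_eventually[OF allI])
    qed
  qed
  then have "AE \<eta> in bond_percolation ?G p. has_infinite_component (retained ?G \<eta>)"
  proof (rule AE_mp, intro AE_I2 impI)
    fix \<eta> assume "\<forall>\<^sub>F n in sequentially. \<forall>F\<in>\<F>' n. \<exists>e\<in>F. \<eta> e"
    then have "\<forall>\<^sub>F n in sequentially. n \<ge> N \<and> (\<forall>F\<in>\<F>' n. \<exists>e\<in>F. \<eta> e)"
      using eventually_ge_at_top eventually_conj by blast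
    then obtain N' where N': "\<And>n. n \<ge> N' \<Longrightarrow> n \<ge> N \<and> (\<forall>F\<in>\<F>' n. \<exists>e\<in>F. \<eta> e)"
      unfolding eventually_sequentially by blast
    have "\<exists>xs. crosses \<eta> n xs" if "n \<ge> N'" for n
      using \<F>(4)[of n \<eta>] N'[OF that] unfolding \<F>'_def by auto
    then have "\<forall>n. \<exists>xs. n \<ge> N' \<longrightarrow> crosses \<eta> n xs" by blast
    from choice[OF this] obtain xs where xs: "\<And>n. n \<ge> N' \<Longrightarrow> crosses \<eta> n (xs n)" by blast
    define r where "r = {(u, v). {u, v} \<in> edges (retained ?G \<eta>)}"
    have sym: "sym r" unfolding r_def sym_def by (simp add: insert_commute)
    have walk: "xs n \<noteq> []" "lattice_walk (xs n)" "set (xs n) \<subseteq> S n"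
      "successively (\<lambda>u v. (u, v) \<in> r) (xs n)" if "n \<ge> N'" for n
    proof -
      have w: "open_walk \<eta> (S n) (xs n)" using xs[OF that] by (simp add: crosses_def)
      then show "xs n \<noteq> []" "lattice_walk (xs n)" "set (xs n) \<subseteq> S n"
        using open_walk_lattice_walk by (auto simp: open_walk_def)
      have "edges (lattice_graph_on (S n)) \<subseteq> edges ?G"
        using sub N' that by (intro edges_lattice_graph_on_mono) auto
      with w show "successively (\<lambda>u v. (u, v) \<in> r) (xs n)"
        unfolding open_walk_def r_def retained_def by (auto elim!: successively_mono)
    qed
    have meet: "set (xs n) \<inter> set (xs (Suc n)) \<noteq> {}" if n: "n \<ge> N'" for n
    proof -
      have n': "Suc n \<ge> N'" "n \<ge> N" using n N' by auto
      note [simp] = next'[OF n'(2)] prev[OF n'(2)]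
      show ?thesis
      proof (cases "even n")
        case True
        have "set (xs (Suc n)) \<inter> set (xs n) \<noteq> {}"
          by (rule crossing_walks_meet[where ?x0.0 = "s (Suc n)" and ?x1.0 = "s (Suc n) + int ((Suc n)\<^sup>2)"
                and ?y0.0 = "s n" and ?y1.0 = "s n + int (n\<^sup>2)"])
             (use walk[OF n] walk[OF n'(1)] xs[OF n] xs[OF n'(1)] True in
                \<open>auto simp: crosses_def S_def long_rect_def simp del: of_nat_power of_nat_Suc\<close>)
        then show ?thesis by blast
      next
        case False
        show ?thesis
          by (rule crossing_walks_meet[where ?x0.0 = "s n" and ?x1.0 = "s n + int (n\<^sup>2)"
                and ?y0.0 = "s (Suc n)" and ?y1.0 = "s (Suc n) + int ((Suc n)\<^sup>2)"])
             (use walk[OF n] walk[OF n'(1)] xs[OF n] xs[OF n'(1)] False in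
                \<open>auto simp: crosses_def S_def long_rect_def simp del: of_nat_power of_nat_Suc\<close>)
      qed
    qed
    define x where "x = hd (xs N')"
    have reach: "\<forall>v\<in>set (xs n). (x, v) \<in> r\<^sup>*" if "n \<ge> N'" for n
      using that
    proof (induction n rule: dec_induct)
      case base
      then show ?case using walk[of N'] sym successively_imp_connected unfolding x_def by (metis hd_in_set order_refl)
    next
      case (step n)
      then obtain u where u: "u \<in> set (xs n)" "u \<in> set (xs (Suc n))" using meet by blast
      show ?case
      proof
        fix v assume "v \<in> set (xs (Suc n))"
        then have "(u, v) \<in> r\<^sup>*" using successively_imp_connected[OF walk(4) sym u(2)] step by auto
        then show "(x, v) \<in> r\<^sup>*" using step u(1) by (meson rtrancl_trans)
      qed
    qed
    have "x \<in> V" using walk(1,3)[of N'] sub[of N'] N'[of N'] unfolding x_def by (auto dest: hd_in_set)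
    moreover have "infinite (component (retained ?G \<eta>) x)"
    proof
      assume fin: "finite (component (retained ?G \<eta>) x)"
      define B where "B = Max ((\<lambda>v. \<bar>fst v\<bar> + \<bar>snd v\<bar>) ` component (retained ?G \<eta>) x)"
      define n where "n = max N' (nat (B + 1))"
      have n: "n \<ge> N'" "n \<ge> N" "B < int n" using N'[of n] by (auto simp: n_def)
      define v where "v = hd (xs n)"
      have v: "v \<in> set (xs n)" using walk(1)[OF n(1)] by (simp add: v_def)
      then have "v \<in> component (retained ?G \<eta>) x"
        using reach[OF n(1)] by (auto simp: component_def r_def)
      then have "\<bar>fst v\<bar> + \<bar>snd v\<bar> \<le> B" unfolding B_def using fin by (intro Max_ge) auto
      moreover have "v \<in> S n" using walk(3)[OF n(1)] v by blast
      then have "int n \<le> \<bar>fst v\<bar> \<or> int n \<le> \<bar>snd v\<bar>"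
        using far[OF n(2)] unfolding S_def long_rect_def by (cases v) (auto split: if_splits)
      ultimately show False using n(3) by linarith
    qed
    ultimately show "has_infinite_component (retained ?G \<eta>)"
      unfolding has_infinite_component_def by (auto simp: retained_def lattice_graph_on_def)
  qed
  then have "p_c_bond ?G \<le> ereal p"
    unfolding p_c_bond_def by (intro INF_lower) (simp, simp add: p_def)
  also have "\<dots> < 1" by (simp add: p_def)
  finally show ?thesis .
qed

section \<open>Strips on growing scales\<close>

text \<open>At level \<open>n\<close>, strips of the two colours alternate at distance \<open>gap n\<close>, orthogonally to the coordinate
  \<open>coord n\<close>; a site at position \<open>z\<close> relative to the offset of the level lies in a strip of colour \<open>b\<close>
  if \<open>z \<in> strip b n\<close>.  The exponent \<open>n\<^sup>2\<close> makes \<open>gap n / gap (Suc n)\<close> summable even after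
  multiplication by the width of the strips, while the width remains comparable to the logarithm
  of the next gap.\<close>

definition gap :: "nat \<Rightarrow> int" where
  "gap n = 4 * 2 ^ (n\<^sup>2)"

definition strip :: "bool \<Rightarrow> nat \<Rightarrow> int set" where
  "strip b n = {z. (z - (if b then 0 else gap n)) mod (2 * gap n) \<le> int (n\<^sup>2) + 2}"

definition coord :: "nat \<Rightarrow> site \<Rightarrow> int" where
  "coord n x = (if even n then snd x else fst x)"

text \<open>The highest level that has a strip at a site decides the colour.  A site in strips of infinitely many
  levels, or of none, gets the colour \<^const>\<open>False\<close>.\<close>

definition coloring :: "(nat \<Rightarrow> int) \<Rightarrow> site \<Rightarrow> bool" where
  "coloring u x \<longleftrightarrow> (\<exists>n. coord n x + u n \<in> strip True n \<and> (\<forall>m>n. \<forall>b. coord m x + u m \<notin> strip b m))"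

lemma gap_pos: "0 < gap n"
  by (simp add: gap_def)

lemma gap_mono: "m \<le> n \<Longrightarrow> gap m \<le> gap n"
  by (simp add: gap_def power_mono)

lemma width_less_gap: "int (n\<^sup>2) + 2 < gap n"
proof -
  have "n\<^sup>2 < 2 ^ (n\<^sup>2)" by (rule less_exp)
  then have "int (n\<^sup>2) < 2 ^ (n\<^sup>2)" by (metis of_nat_less_iff of_nat_numeral of_nat_power)
  moreover have "(1 :: int) \<le> 2 ^ (n\<^sup>2)" by simp
  ultimately show ?thesis unfolding gap_def by linarith
qed

lemma Suc_le_gap: "int (Suc n) \<le> gap n"
proof -
  have "n < 2 ^ n" by (rule less_exp)
  also have "(2 :: nat) ^ n \<le> 2 ^ (n\<^sup>2)" by (rule power_increasing) (auto simp: power2_eq_square)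
  finally have "int n < 2 ^ (n\<^sup>2)" by (metis of_nat_less_iff of_nat_numeral of_nat_power)
  then show ?thesis unfolding gap_def by linarith
qed

text \<open>The strips of the two colours are translates of each other by \<open>gap n\<close>, half a period.\<close>

lemma mem_strip_not_iff:
  "z \<in> strip (\<not> b) n \<longleftrightarrow> (z - (if b then 0 else gap n) + gap n) mod (2 * gap n) \<le> int (n\<^sup>2) + 2"
proof (cases b)
  case True
  have "(z - gap n) mod (2 * gap n) = (z - gap n + 2 * gap n) mod (2 * gap n)" by (rule mod_add_self2[symmetric])
  also have "z - gap n + 2 * gap n = z + gap n" by simp
  finally show ?thesis using True by (simp add: strip_def)
qed (simp add: strip_def)

lemma strip_disjoint: "z \<in> strip b n \<Longrightarrow> z \<notin> strip (\<not> b) n"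
proof
  define r where "r = (z - (if b then 0 else gap n)) mod (2 * gap n)"
  assume "z \<in> strip b n"
  then have "r \<le> int (n\<^sup>2) + 2" by (simp only: strip_def r_def mem_Collect_eq)
  moreover assume "z \<in> strip (\<not> b) n"
  then have "(r + gap n) mod (2 * gap n) \<le> int (n\<^sup>2) + 2"
    by (simp only: mem_strip_not_iff r_def mod_add_left_eq)
  moreover have "0 \<le> r" using gap_pos[of n] by (simp add: r_def)
  moreover note width_less_gap[of n]
  ultimately show False by simp
qed

lemma coloring_eqI:
  assumes n: "coord n x + u n \<in> strip b n" and above: "\<And>m b. m > n \<Longrightarrow> coord m x + u m \<notin> strip b m"
  shows "coloring u x = b"
proof (cases b)
  case True
  then show ?thesis using assms unfolding coloring_def by auto
next
  case False
  have "\<not> coloring u x"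
  proof
    assume "coloring u x"
    then obtain k where k: "coord k x + u k \<in> strip True k" "\<And>m b. m > k \<Longrightarrow> coord m x + u m \<notin> strip b m"
      unfolding coloring_def by blast
    with n above have "k = n" by (metis linorder_neqE_nat)
    then show False using k(1) n strip_disjoint False by fastforce
  qed
  then show ?thesis using False by simp
qed

text \<open>Of the two strips next to \<open>0\<close>, one on each side, one has colour \<open>b\<close>, so it can be reached without meeting a
  strip of the other colour.  The coordinate \<open>z\<close> of \<open>0\<close>, measured from a strip of colour \<open>b\<close>, tells
  on which side it lies.  The strip has one more site on each side than the interval from \<open>s\<close> to
  \<open>s + n\<^sup>2\<close>: this leaves room for crossing it completely.\<close>

lemma nearest_strip:
  assumes "\<And>b. a \<notin> strip b n"
  obtains s where
    "\<And>c. c \<in> {s - 1..s + int (n\<^sup>2) + 1} \<Longrightarrow> c + a \<in> strip b n \<and> \<bar>c\<bar> < gap n"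
    "\<And>c. 0 \<le> c \<Longrightarrow> c \<le> s + int (n\<^sup>2) + 1 \<Longrightarrow> c + a \<notin> strip (\<not> b) n"
    "\<And>c. s - 1 \<le> c \<Longrightarrow> c \<le> 0 \<Longrightarrow> c + a \<notin> strip (\<not> b) n"
proof -
  define g where "g = gap n"
  define w where "w = int (n\<^sup>2) + 2"
  define z where "z = (a - (if b then 0 else g)) mod (2 * g)"
  have g: "0 \<le> w" "w < g" "0 < g" using width_less_gap[of n] gap_pos by (auto simp: g_def w_def)
  have z: "0 \<le> z" "z < 2 * g" using g by (auto simp: z_def)
  have same: "c + a \<in> strip b n \<longleftrightarrow> (c + z) mod (2 * g) \<le> w" for c
    unfolding strip_def z_def g_def w_def by (simp add: mod_simps algebra_simps)
  have other: "c + a \<in> strip (\<not> b) n \<longleftrightarrow> (c + z + g) mod (2 * g) \<le> w" for c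
    unfolding mem_strip_not_iff z_def g_def w_def
    using mod_add_left_eq[of "a - (if b then 0 else gap n)" "2 * gap n" "c + gap n"]
    by (simp add: algebra_simps)
  show thesis
  proof (cases "z < g")
    case True
    have zw: "w < z" using assms[of b] same[of 0] z by auto
    show thesis
    proof (rule that[of "1 - z"])
      fix c assume "c \<in> {1 - z - 1..1 - z + int (n\<^sup>2) + 1}"
      then have c: "0 \<le> c + z" "c + z \<le> w" by (auto simp: w_def)
      then have "(c + z) mod (2 * g) = c + z" using g by simp
      then show "c + a \<in> strip b n \<and> \<bar>c\<bar> < gap n" using c zw True unfolding same g_def[symmetric] by auto
    next
      fix c assume "0 \<le> c" "c \<le> 1 - z + int (n\<^sup>2) + 1"
      then show "c + a \<notin> strip (\<not> b) n" using zw by (auto simp: w_def)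
    next
      fix c assume "1 - z - 1 \<le> c" "c \<le> 0"
      then have "(c + z + g) mod (2 * g) = c + z + g" using True by simp
      then show "c + a \<notin> strip (\<not> b) n" unfolding other using \<open>1 - z - 1 \<le> c\<close> g by auto
    qed
  next
    case False
    have shift: "(x + 2 * g) mod (2 * g) = x" if "0 \<le> x" "x < 2 * g" for x using that by simp
    have "(z + g) mod (2 * g) = z - g" using shift[of "z - g"] False z by (simp add: add.commute)
    then have zw: "w < z - g" using assms[of "\<not> b"] other[of 0] by auto
    show thesis
    proof (rule that[of "2 * g - z + 1"])
      fix c assume "c \<in> {2 * g - z + 1 - 1..2 * g - z + 1 + int (n\<^sup>2) + 1}"
      then have c: "2 * g \<le> c + z" "c + z \<le> 2 * g + w" by (auto simp: w_def)
      then have "(c + z) mod (2 * g) = c + z - 2 * g" using g shift[of "c + z - 2 * g"] by simp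
      then show "c + a \<in> strip b n \<and> \<bar>c\<bar> < gap n" using c zw z unfolding same g_def[symmetric] by auto
    next
      fix c assume c: "0 \<le> c" "c \<le> 2 * g - z + 1 + int (n\<^sup>2) + 1"
      have "0 \<le> c + z - g" "c + z - g < 2 * g" using c g zw unfolding w_def by linarith+
      moreover have "c + z + g = c + z - g + 2 * g" by simp
      ultimately have "(c + z + g) mod (2 * g) = c + z - g" by (simp only: shift)
      then show "c + a \<notin> strip (\<not> b) n" unfolding other using zw c by auto
    next
      fix c assume "2 * g - z + 1 - 1 \<le> c" "c \<le> 0"
      then show "c + a \<notin> strip (\<not> b) n" using z by auto
    qed
  qed
qed

definition far_strips :: "(nat \<Rightarrow> int) \<Rightarrow> nat \<Rightarrow> bool" where
  "far_strips u n \<longleftrightarrow> (\<forall>c b. \<bar>c\<bar> \<le> gap n \<longrightarrow> c + u (Suc n) \<notin> strip b (Suc n))"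

text \<open>The \<open>n\<close>-th rectangle runs along the strip of level \<open>n\<close> and colour \<open>b\<close> nearest to the origin, from beyond
  the strip of level \<open>n - 1\<close> to beyond the strip of level \<open>n + 1\<close>.  Only the levels above \<open>n\<close> could
  spoil its colour.  Level \<open>n + 1\<close> has only its own strip of colour \<open>b\<close> there, by the choice of this strip,
  and the strips of levels from \<open>n + 2\<close> on are too far away.\<close>

lemma corridor_in_coloring:
  assumes far: "\<And>n. n \<ge> N \<Longrightarrow> far_strips u n"
  shows "\<exists>s lo hi. corridor {x. coloring u x = b} (Suc N) s lo hi"
proof -
  have avoid: "c + u n \<notin> strip b n" if "n \<ge> Suc N" "\<bar>c\<bar> \<le> gap (n - 1)" for n c b
    using far[of "n - 1"] that by (auto simp: far_strips_def)
  have "\<exists>s. n \<ge> Suc N \<longrightarrow>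
      (\<forall>c\<in>{s - 1..s + int (n\<^sup>2) + 1}. c + u n \<in> strip b n \<and> \<bar>c\<bar> < gap n) \<and>
      (\<forall>c. 0 \<le> c \<longrightarrow> c \<le> s + int (n\<^sup>2) + 1 \<longrightarrow> c + u n \<notin> strip (\<not> b) n) \<and>
      (\<forall>c. s - 1 \<le> c \<longrightarrow> c \<le> 0 \<longrightarrow> c + u n \<notin> strip (\<not> b) n)" for n
  proof (cases "n \<ge> Suc N")
    case True
    have "u n \<notin> strip b n" for b using avoid[OF True, of 0 b] gap_pos[of "n - 1"] by simp
    from nearest_strip[OF this, of b] show ?thesis by metis
  qed simp
  then obtain s where s:
    "\<And>n c. n \<ge> Suc N \<Longrightarrow> c \<in> {s n - 1..s n + int (n\<^sup>2) + 1} \<Longrightarrow> c + u n \<in> strip b n \<and> \<bar>c\<bar> < gap n"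
    "\<And>n c. n \<ge> Suc N \<Longrightarrow> 0 \<le> c \<Longrightarrow> c \<le> s n + int (n\<^sup>2) + 1 \<Longrightarrow> c + u n \<notin> strip (\<not> b) n"
    "\<And>n c. n \<ge> Suc N \<Longrightarrow> s n - 1 \<le> c \<Longrightarrow> c \<le> 0 \<Longrightarrow> c + u n \<notin> strip (\<not> b) n"
    by metis
  have s_far: "gap (n - 1) < \<bar>c\<bar>" if "n \<ge> Suc N" "c \<in> {s n - 1..s n + int (n\<^sup>2) + 1}" for n c
    using s(1)[OF that] avoid[OF that(1), of c] by force
  have s_near: "\<bar>s n - 1\<bar> < gap n" "\<bar>s n + int (n\<^sup>2) + 1\<bar> < gap n" if "n \<ge> Suc N" for n
    using s(1)[OF that, of "s n - 1"] s(1)[OF that, of "s n + int (n\<^sup>2) + 1"] by auto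
  have side: "s n - 1 > gap (n - 1) \<or> s n + int (n\<^sup>2) + 1 < - gap (n - 1)" if "n \<ge> Suc N" for n
    using s_far[OF that, of "s n - 1"] s_far[OF that, of "s n + int (n\<^sup>2) + 1"] s_far[OF that, of 0] gap_pos[of "n - 1"]
    unfolding atLeastAtMost_iff by linarith
  \<comment> \<open>On the side away from the strip of level \<open>n + 1\<close>, the rectangle stops at distance \<open>gap (n - 1)\<close>,
    which is beyond the strip of level \<open>n - 1\<close> and below the reach of level \<open>n + 1\<close>.\<close>
  define lo where "lo n = (if s (Suc n) > 0 then - gap (n - 1) else s (Suc n) - 1)" for n
  define hi where "hi n = (if s (Suc n) > 0 then s (Suc n) + int ((Suc n)\<^sup>2) + 1 else gap (n - 1))" for n
  have gap_chain: "gap (n - 1) \<le> gap n" "gap n \<le> gap (Suc n)" "gap n \<le> gap (n + 2)" for n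
    by (rule gap_mono, simp)+
  have along: "\<bar>d\<bar> \<le> gap (Suc n) \<and> d + u (Suc n) \<notin> strip (\<not> b) (Suc n)"
    if n: "n \<ge> Suc N" and d: "d \<in> {lo n..hi n}" for n d
  proof (cases "\<bar>d\<bar> \<le> gap (n - 1)")
    case True
    then show ?thesis using avoid[of "Suc n" d] n gap_chain[of n] by auto
  next
    case False
    have "0 \<le> d \<and> d \<le> s (Suc n) + int ((Suc n)\<^sup>2) + 1 \<or> s (Suc n) - 1 \<le> d \<and> d \<le> 0"
      using False d by (auto simp: lo_def hi_def split: if_splits)
    moreover have "Suc n \<ge> Suc N" using n by simp
    ultimately show ?thesis using s(2,3) s_near[of "Suc n"] by force
  qed
  have "corridor {x. coloring u x = b} (Suc N) s lo hi"
    unfolding corridor_def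
  proof (intro allI impI conjI ballI)
    fix n assume n: "n \<ge> Suc N"
    have n': "Suc n \<ge> Suc N" using n by simp
    have n'': "Suc (Suc n) \<ge> Suc N" using n by simp
    have colored: "coloring u x = b"
      if c: "coord n x \<in> {s n..s n + int (n\<^sup>2)}" and d: "coord (Suc n) x \<in> {lo n..hi n}" for x
    proof -
      have c': "coord n x + u n \<in> strip b n" "\<bar>coord n x\<bar> < gap n"
        using s(1)[OF n, of "coord n x"] c by auto
      note d' = along[OF n d]
      have above: "coord m x + u m \<notin> strip b' m" if "m \<ge> n + 2" for m b'
      proof -
        have "\<bar>coord m x\<bar> \<le> gap (Suc n)"
          using c' d' gap_chain[of n] by (auto simp: coord_def split: if_splits)
        also have "\<dots> \<le> gap (m - 1)" using that by (intro gap_mono) auto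
        finally show ?thesis using avoid that n by auto
      qed
      show ?thesis
      proof (cases "coord (Suc n) x + u (Suc n) \<in> strip b (Suc n)")
        case True
        then show ?thesis by (rule coloring_eqI) (use above in auto)
      next
        case False
        have "coord m x + u m \<notin> strip b' m" if "m > n" for m b'
        proof (cases "m = Suc n")
          case True
          then show ?thesis using d' False by (cases "b' = b") auto
        next
          case False
          then show ?thesis using above that by auto
        qed
        then show ?thesis using c'(1) by (intro coloring_eqI) auto
      qed
    qed
    then show "long_rect n (s n) (lo n) (hi n) \<subseteq> {x. coloring u x = b}"
      by (auto simp: long_rect_def coord_def simp del: of_nat_power)
    show "lo n < s (Suc n)" "s (Suc n) + int ((Suc n)\<^sup>2) < hi n"
      using side[OF n'] gap_pos[of n] gap_pos[of "n - 1"] unfolding lo_def hi_def by auto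
    have "lo (Suc n) < s n \<and> s n + int (n\<^sup>2) < hi (Suc n)"
    proof -
      have "s (Suc (Suc n)) - 1 > gap (Suc n) \<or> s (Suc (Suc n)) + int ((Suc (Suc n))\<^sup>2) + 1 < - gap (Suc n)"
        using side[OF n''] by (simp only: diff_Suc_1)
      moreover have "lo (Suc n) = (if s (Suc (Suc n)) > 0 then - gap n else s (Suc (Suc n)) - 1)"
        "hi (Suc n) = (if s (Suc (Suc n)) > 0 then s (Suc (Suc n)) + int ((Suc (Suc n))\<^sup>2) + 1 else gap n)"
        by (simp_all only: lo_def hi_def diff_Suc_1)
      moreover have "0 \<le> int ((Suc (Suc n))\<^sup>2)" "0 \<le> int (n\<^sup>2)" by simp_all
      moreover note s_near[OF n] gap_pos[of n] gap_chain[of n]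
      ultimately show ?thesis by (cases "s (Suc (Suc n)) > 0") (simp_all only: if_True if_False, linarith+)
    qed
    then show "lo (Suc n) < s n" "s n + int (n\<^sup>2) < hi (Suc n)" by blast+
    have "hi n - lo n \<le> 2 * gap (Suc n)"
      using s_near[OF n'] gap_chain[of n] unfolding lo_def hi_def by auto
    then show "hi n - lo n \<le> 8 * 2 ^ ((Suc n)\<^sup>2)" by (simp add: gap_def)
    fix c assume "c \<in> {s n..s n + int (n\<^sup>2)}"
    then have "gap (n - 1) < \<bar>c\<bar>" by (intro s_far[OF n]) auto
    then show "int n \<le> \<bar>c\<bar>" using Suc_le_gap[of "n - 1"] n by auto
  qed
  then show ?thesis by blast
qed

section \<open>Random offsets\<close>

text \<open>Independent offsets, uniform over a full period: a translation of the plane rotates every offset,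
  which preserves the measure.\<close>

definition offsets :: "(nat \<Rightarrow> int) measure" where
  "offsets = (\<Pi>\<^sub>M n\<in>UNIV. measure_pmf (pmf_of_set {0..<2 * gap n}))"

interpretation offsets: product_prob_space "\<lambda>n. measure_pmf (pmf_of_set {0..<2 * gap n})" UNIV
  by unfold_locales

lemma prob_space_offsets: "prob_space offsets"
  unfolding offsets_def by (rule offsets.P.prob_space_axioms)

lemma space_offsets [simp]: "space offsets = UNIV"
  by (simp add: offsets_def space_PiM)

lemma measurable_offset [measurable]: "(\<lambda>u. u n) \<in> measurable offsets (count_space UNIV)"
proof -
  have "(\<lambda>u. u n) \<in> measurable offsets (measure_pmf (pmf_of_set {0..<2 * gap n}))"
    unfolding offsets_def by (rule measurable_component_singleton) simp
  then show ?thesis by (simp cong: measurable_cong_sets)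
qed

lemma emeasure_offset: "emeasure offsets {u. u n \<in> A} = emeasure (measure_pmf (pmf_of_set {0..<2 * gap n})) A"
  using offsets.emeasure_PiM_Collect_single[of n A] by (simp add: offsets_def space_PiM)

definition translate :: "site \<Rightarrow> (nat \<Rightarrow> int) \<Rightarrow> nat \<Rightarrow> int" where
  "translate y u n = (u n + coord n y) mod (2 * gap n)"

lemma coloring_translate: "coloring (translate y u) = (\<lambda>x. coloring u (x + y))"
proof
  fix x
  have "coord n x + translate y u n \<in> strip b n \<longleftrightarrow> coord n (x + y) + u n \<in> strip b n" for n b
    unfolding strip_def translate_def mem_Collect_eq
    using mod_add_left_eq[of "u n + coord n y" "2 * gap n" "coord n x - (if b then 0 else gap n)"]
    by (simp add: coord_def algebra_simps)
  then show "coloring (translate y u) x = coloring u (x + y)" unfolding coloring_def by simp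
qed

lemma measurable_translate [measurable]: "translate y \<in> measurable offsets offsets"
proof -
  have "(\<lambda>u n. (u n + coord n y) mod (2 * gap n)) \<in> measurable offsets
      (\<Pi>\<^sub>M n\<in>UNIV. measure_pmf (pmf_of_set {0..<2 * gap n}))"
  proof (rule measurable_PiM_single')
    show "(\<lambda>u. (u n + coord n y) mod (2 * gap n)) \<in> measurable offsets (measure_pmf (pmf_of_set {0..<2 * gap n}))" for n
      by (subst measurable_cong_sets[OF refl sets_measure_pmf_count_space]) measurable
  qed auto
  then show ?thesis by (simp add: translate_def[abs_def] offsets_def)
qed

lemma map_pmf_rotate:
  assumes "0 < m"
  shows "map_pmf (\<lambda>z. (z + a) mod m) (pmf_of_set {0..<m :: int}) = pmf_of_set {0..<m}"
proof (rule map_pmf_of_set_bij_betw)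
  show "bij_betw (\<lambda>z. (z + a) mod m) {0..<m} {0..<m}"
    by (rule bij_betw_byWitness[where f' = "\<lambda>z. (z - a) mod m"]) (use assms in \<open>auto simp: mod_simps\<close>)
qed (use assms in auto)

lemma distr_translate: "distr offsets offsets (translate y) = offsets"
proof -
  let ?U = "\<lambda>n. measure_pmf (pmf_of_set {0..<2 * gap n})"
  have "PiM UNIV ?U = distr offsets offsets (translate y)"
  proof (rule offsets.PiM_eq[symmetric])
    show "sets (distr offsets offsets (translate y)) = sets (PiM UNIV ?U)" by (simp add: offsets_def)
    fix J F assume J: "finite J" "J \<subseteq> (UNIV :: nat set)" and F: "\<And>j. j \<in> J \<Longrightarrow> F j \<in> sets (?U j)"
    let ?rot = "\<lambda>j z. (z + coord j y) mod (2 * gap j)"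
    have "emeasure (distr offsets offsets (translate y)) (prod_emb UNIV ?U J (\<Pi>\<^sub>E j\<in>J. F j)) =
        emeasure offsets (translate y -` prod_emb UNIV ?U J (\<Pi>\<^sub>E j\<in>J. F j) \<inter> space offsets)"
      by (rule emeasure_distr[OF measurable_translate]) (use J F in \<open>simp add: offsets_def sets_PiM_I\<close>)
    also have "translate y -` prod_emb UNIV ?U J (\<Pi>\<^sub>E j\<in>J. F j) \<inter> space offsets =
        prod_emb UNIV ?U J (\<Pi>\<^sub>E j\<in>J. ?rot j -` F j)"
      by (auto simp: prod_emb_def restrict_PiE_iff Pi_iff translate_def)
    also have "emeasure offsets \<dots> = (\<Prod>j\<in>J. emeasure (?U j) (?rot j -` F j))"
      unfolding offsets_def by (rule offsets.emeasure_PiM_emb) (use J in auto)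
    also have "\<dots> = (\<Prod>j\<in>J. emeasure (?U j) (F j))"
    proof (rule prod.cong[OF refl])
      fix j
      have "emeasure (measure_pmf (map_pmf (?rot j) (pmf_of_set {0..<2 * gap j}))) (F j) = emeasure (?U j) (?rot j -` F j)"
        by simp
      then show "emeasure (?U j) (?rot j -` F j) = emeasure (?U j) (F j)"
        using map_pmf_rotate[of "2 * gap j" "coord j y"] gap_pos[of j] by simp
    qed
    finally show "emeasure (distr offsets offsets (translate y)) (prod_emb UNIV ?U J (\<Pi>\<^sub>E j\<in>J. F j)) =
        (\<Prod>j\<in>J. emeasure (?U j) (F j))" .
  qed
  then show ?thesis by (simp add: offsets_def)
qed

lemma measurable_coloring [measurable]: "(\<lambda>u. coloring u x) \<in> measurable offsets (count_space UNIV)"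
  unfolding coloring_def by measurable

text \<open>A bad offset is determined by the place \<open>c\<close> near the origin where a strip appears, by the position \<open>z\<close>
  within that strip, and by its colour.  So the proportion of bad offsets is at most about \<open>gap n\<close>
  times the width of a strip over \<open>gap (Suc n)\<close>.\<close>

lemma measure_not_far_strips_le:
  "measure offsets {u. \<not> far_strips u n} \<le> 9 / 2 * (1 / 2) ^ n"
proof -
  define g G w where "g = gap n" and "G = gap (Suc n)" and "w = int ((Suc n)\<^sup>2) + 2"
  have pos: "0 < g" "0 < G" "0 \<le> w" using gap_pos by (auto simp: g_def G_def w_def)
  define B where "B = {a. \<exists>c b. \<bar>c\<bar> \<le> g \<and> c + a \<in> strip b (Suc n)}"
  have "{u. \<not> far_strips u n} = {u. u (Suc n) \<in> B}"
    by (auto simp: far_strips_def B_def g_def)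
  then have "measure offsets {u. \<not> far_strips u n} = measure (measure_pmf (pmf_of_set {0..<2 * G})) B"
    by (simp add: measure_def emeasure_offset G_def)
  also have "\<dots> = real (card ({0..<2 * G} \<inter> B)) / real (card {0..<2 * G})"
    using pos by (simp add: measure_pmf_of_set)
  also have "real (card ({0..<2 * G} \<inter> B)) \<le> real_of_int ((2 * g + 1) * (w + 1) * 2)"
  proof -
    let ?f = "\<lambda>(c, z, b). (z + (if b then 0 else G) - c) mod (2 * G)"
    let ?D = "{-g..g} \<times> {0..w} \<times> (UNIV :: bool set)"
    have "{0..<2 * G} \<inter> B \<subseteq> ?f ` ?D"
    proof
      fix a assume "a \<in> {0..<2 * G} \<inter> B"
      then obtain c b where a: "0 \<le> a" "a < 2 * G" "\<bar>c\<bar> \<le> g" "c + a \<in> strip b (Suc n)"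
        by (auto simp: B_def)
      define z where "z = (c + a - (if b then 0 else G)) mod (2 * G)"
      have z: "0 \<le> z" "z \<le> w" using a pos by (auto simp: z_def strip_def w_def G_def)
      have "?f (c, z, b) = (c + a - (if b then 0 else G) + ((if b then 0 else G) - c)) mod (2 * G)"
        unfolding z_def prod.case using mod_add_left_eq[of "c + a - (if b then 0 else G)" "2 * G" "(if b then 0 else G) - c"]
        by (simp only: add_diff_eq)
      also have "\<dots> = a" using a by simp
      finally show "a \<in> ?f ` ?D" using z a by (intro image_eqI[where x = "(c, z, b)"]) auto
    qed
    then have "card ({0..<2 * G} \<inter> B) \<le> card ?D"
      by (intro surj_card_le) auto
    then have "int (card ({0..<2 * G} \<inter> B)) \<le> int (card ?D)" by (simp only: of_nat_le_iff)
    also have "int (card ?D) = (2 * g + 1) * (w + 1) * 2"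
      using pos by (simp add: card_cartesian_product)
    finally have "real_of_int (int (card ({0..<2 * G} \<inter> B))) \<le> real_of_int ((2 * g + 1) * (w + 1) * 2)"
      by (simp only: of_int_le_iff)
    then show ?thesis by simp
  qed
  also have "real (card {0..<2 * G}) = real_of_int (2 * G)" using pos by simp
  finally have "measure offsets {u. \<not> far_strips u n} \<le>
      real_of_int ((2 * g + 1) * (w + 1) * 2) / real_of_int (2 * G)"
    using pos by (simp add: divide_right_mono)
  also have "\<dots> = (8 * 2 ^ (n\<^sup>2) + 1) * (real ((Suc n)\<^sup>2) + 3) / (4 * 2 ^ ((Suc n)\<^sup>2))"
    by (simp add: g_def G_def w_def gap_def field_simps)
  also have "\<dots> \<le> (9 * 2 ^ (n\<^sup>2)) * (real ((Suc n)\<^sup>2) + 3) / (4 * 2 ^ ((Suc n)\<^sup>2))"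
    by (intro divide_right_mono mult_right_mono) auto
  also have "(2 :: real) ^ ((Suc n)\<^sup>2) = 2 * 2 ^ (n\<^sup>2) * 4 ^ n"
  proof -
    have "(Suc n)\<^sup>2 = 1 + n\<^sup>2 + 2 * n" by (simp add: power2_eq_square)
    then show ?thesis by (simp only: power_add power_mult) simp
  qed
  also have "9 * 2 ^ (n\<^sup>2) * (real ((Suc n)\<^sup>2) + 3) / (4 * (2 * 2 ^ (n\<^sup>2) * 4 ^ n)) =
      9 / 8 * (real ((Suc n)\<^sup>2) + 3) / 4 ^ n" by (simp add: field_simps)
  also have "\<dots> \<le> 9 / 8 * (4 * 2 ^ n) / 4 ^ n"
  proof -
    have "real ((Suc n)\<^sup>2) + 3 \<le> 4 * 2 ^ n"
    proof (induction n)
      case (Suc n)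
      have "real ((Suc (Suc n))\<^sup>2) = real n * real n + 4 * real n + 4"
        "real ((Suc n)\<^sup>2) = real n * real n + 2 * real n + 1" "0 \<le> real n * real n"
        by (simp_all add: power2_eq_square algebra_simps)
      with Suc show ?case unfolding power_Suc by linarith
    qed simp
    then show ?thesis by (intro divide_right_mono mult_left_mono) auto
  qed
  also have "\<dots> = 9 / 2 * (1 / 2) ^ n"
    using power_mult_distrib[of "2 :: real" 2 n] by (simp add: power_one_over field_simps)
  finally show ?thesis .
qed

lemma AE_eventually_far_strips: "AE u in offsets. \<forall>\<^sub>F n in sequentially. far_strips u n"
proof -
  interpret prob_space offsets by (rule prob_space_offsets)
  have meas: "{u. \<not> far_strips u n} \<in> sets offsets" for n
  proof -
    have "{u \<in> space offsets. \<not> far_strips u n} \<in> sets offsets"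
      unfolding far_strips_def by measurable
    then show ?thesis by simp
  qed
  have "AE u in offsets. \<forall>\<^sub>F n in sequentially. u \<in> space offsets - {u. \<not> far_strips u n}"
  proof (rule borel_cantelli_AE1[OF meas])
    show "emeasure offsets {u. \<not> far_strips u n} < \<infinity>" for n by (simp add: emeasure_eq_measure)
    have "summable (\<lambda>n. 9 / 2 * (1 / 2) ^ n :: real)" by (intro summable_mult summable_geometric) auto
    then show "summable (\<lambda>n. measure offsets {u. \<not> far_strips u n})"
      by (rule summable_comparison_test_ev[rotated]) (use measure_not_far_strips_le in auto)
  qed
  then show ?thesis by simp
qed

lemma p_c_bond_coloring_less_1:
  "AE u in offsets. \<forall>b. p_c_bond (lattice_graph_on {x. coloring u x = b}) < 1"
  using AE_eventually_far_strips
proof (rule AE_mp, intro AE_I2 impI allI)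
  fix u b assume "\<forall>\<^sub>F n in sequentially. far_strips u n"
  then obtain N where "\<And>n. n \<ge> N \<Longrightarrow> far_strips u n" unfolding eventually_sequentially by blast
  from corridor_in_coloring[of N u b, OF this]
  show "p_c_bond (lattice_graph_on {x. coloring u x = b}) < 1"
    using p_c_bond_less_1_if_corridor by blast
qed

lemma measurable_restrict_to_list:
  fixes xs :: "'a list"
  shows "(\<lambda>\<omega>. map \<omega> xs) \<in> measurable (\<Pi>\<^sub>M x\<in>UNIV. count_space UNIV) (count_space (UNIV :: bool list set))"
proof (subst measurable_count_space_eq2_countable, intro conjI ballI)
  fix l :: "bool list"
  have "(\<lambda>\<omega>. map \<omega> xs) -` {l} \<inter> space (\<Pi>\<^sub>M x\<in>UNIV. count_space UNIV) =
      {\<omega> \<in> space (\<Pi>\<^sub>M x\<in>UNIV. count_space UNIV). length xs = length l \<and> (\<forall>i<length xs. \<omega> (xs ! i) = l ! i)}"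
    by (auto simp: list_eq_iff_nth_eq)
  also have "\<dots> \<in> sets (\<Pi>\<^sub>M x\<in>UNIV. count_space UNIV)" by measurable
  finally show "(\<lambda>\<omega>. map \<omega> xs) -` {l} \<inter> space (\<Pi>\<^sub>M x\<in>UNIV. count_space UNIV)
      \<in> sets (\<Pi>\<^sub>M x\<in>UNIV. count_space (UNIV :: bool set))" .
qed auto

text \<open>The probability space in the theorem has underlying type \<^typ>\<open>site \<Rightarrow> bool\<close>, so a sequence of offsets is stored as its graph
  in the right half-plane.  Working with the offsets themselves instead of the law of
  \<^const>\<open>coloring\<close> avoids having to show that the event in question is measurable.\<close>

definition encode :: "(nat \<Rightarrow> int) \<Rightarrow> site \<Rightarrow> bool" where
  "encode u x \<longleftrightarrow> 0 \<le> fst x \<and> u (nat (fst x)) = snd x"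

lemma inj_encode: "inj encode"
proof (rule injI, rule ext)
  fix u v n assume "encode u = encode v"
  then have "encode v (int n, u n)" by (metis encode_def fst_conv nat_int of_nat_0_le_iff snd_conv)
  then show "u n = v n" by (simp add: encode_def)
qed

section \<open>Coexistence\<close>

theorem theorem3p2:
  "\<exists>(M :: (site \<Rightarrow> bool) measure) (X :: (site \<Rightarrow> bool) \<Rightarrow> site \<Rightarrow> bool).
     site_percolation M X \<and> translation_invariant M X \<and>
     (AE \<omega> in M. p_c_bond (G_open (X \<omega>)) < 1 \<and> p_c_bond (G_closed (X \<omega>)) < 1)"
proof -
  define M where "M = embed_measure offsets encode"
  define X where "X \<omega> = coloring (inv encode \<omega>)" for \<omega>
  have X_encode: "X (encode u) = coloring u" for u by (simp add: X_def inj_encode)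
  note [measurable] = measurable_embed_measure2[OF inj_encode, of offsets, folded M_def]
  have M_distr: "M = distr offsets M encode"
    unfolding M_def by (rule embed_measure_eq_distr[OF inj_encode])
  have coloring: "coloring \<in> measurable offsets (\<Pi>\<^sub>M x\<in>UNIV. count_space UNIV)"
    by (rule measurable_PiM_single') (auto simp: measurable_coloring)
  then have X: "X \<in> measurable M (\<Pi>\<^sub>M x\<in>UNIV. count_space UNIV)"
    unfolding M_def by (intro measurable_embed_measure1) (simp add: X_encode)
  have "prob_space M"
    by (subst M_distr) (intro prob_space.prob_space_distr prob_space_offsets; measurable)
  with X have "site_percolation M X" by (simp add: site_percolation_def)
  moreover have "translation_invariant M X"
  proof -
    have "distr M (count_space UNIV) (\<lambda>\<omega>. map (\<lambda>x. X \<omega> (x + y)) xs) =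
        distr offsets (count_space UNIV) (\<lambda>u. map (coloring u) xs)" for xs y
    proof -
      have meas: "(\<lambda>u. map (coloring u) xs) \<in> measurable offsets (count_space UNIV)" for xs
        by (rule measurable_compose[OF coloring measurable_restrict_to_list])
      have "(\<lambda>\<omega>. map (X \<omega>) (map (\<lambda>x. x + y) xs)) \<in> measurable M (count_space UNIV)"
        by (rule measurable_compose[OF X measurable_restrict_to_list])
      then have "(\<lambda>\<omega>. map (\<lambda>x. X \<omega> (x + y)) xs) \<in> measurable M (count_space UNIV)"
        by (simp add: o_def)
      then have "distr M (count_space UNIV) (\<lambda>\<omega>. map (\<lambda>x. X \<omega> (x + y)) xs) =
          distr offsets (count_space UNIV) (\<lambda>u. map (coloring (translate y u)) xs)"
        by (subst M_distr) (simp add: distr_distr o_def X_encode coloring_translate)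
      also have "\<dots> = distr (distr offsets offsets (translate y)) (count_space UNIV) (\<lambda>u. map (coloring u) xs)"
        using meas by (simp add: distr_distr o_def)
      finally show ?thesis by (simp add: distr_translate)
    qed
    then show ?thesis by (simp add: translation_invariant_def)
  qed
  moreover have "AE \<omega> in M. p_c_bond (G_open (X \<omega>)) < 1 \<and> p_c_bond (G_closed (X \<omega>)) < 1"
  proof -
    have "AE u in offsets. p_c_bond (G_open (coloring u)) < 1 \<and> p_c_bond (G_closed (coloring u)) < 1"
      using p_c_bond_coloring_less_1
      by (rule AE_mp, intro AE_I2 impI) (auto simp: G_open_def G_closed_def dest: spec[of _ True] spec[of _ False])
    then show ?thesis
      unfolding M_def using inj_encode by (subst AE_embed_measure) (auto simp: X_encode)
  qed
  ultimately show ?thesis by blast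
qed

end
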